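(* Let $S,T\in W^{1,2}(\mathbb{R}^2,\mathbb{R}^2)$ satisfy $S^x\ge0$, $T^y\ge0$ and $\det(S,T)\ge0$ a.e. Then $$\int_{\mathbb{R}^2}\det(S,T)\le\frac14\Big(\int_{\mathbb{R}^2}|\operatorname{div}S|\Big)\Big(\int_{\mathbb{R}^2}|\operatorname{div}T|\Big).$$
   Context: Components are written $S=(S^x,S^y)$, $T=(T^x,T^y)$, and $\det(S,T)=S^xT^y-S^yT^x$. *)

theory Defs
  imports "HOL-Analysis.Analysis"
begin

definition partial_deriv :: "'n \<Rightarrow> (real ^ 'n \<Rightarrow> real) \<Rightarrow> real ^ 'n \<Rightarrow> real"
  where "partial_deriv i f x = frechet_derivative f (at x) (axis i 1)"

fun C_k :: "nat \<Rightarrow> (real ^ 'n \<Rightarrow> real) \<Rightarrow> bool"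
  where
    "C_k 0 f \<longleftrightarrow> continuous_on UNIV f"
  | "C_k (Suc k) f \<longleftrightarrow> (\<forall>x. f differentiable at x) \<and> (\<forall>i. C_k k (partial_deriv i f))"

definition test_function :: "(real ^ 'n \<Rightarrow> real) \<Rightarrow> bool"
  where "test_function \<phi> \<longleftrightarrow> (\<forall>k. C_k k \<phi>) \<and> compact (closure {x. \<phi> x \<noteq> 0})"

definition locally_integrable :: "(real ^ 'n \<Rightarrow> real) \<Rightarrow> bool"
  where "locally_integrable f \<longleftrightarrow> (\<forall>K. compact K \<longrightarrow> f absolutely_integrable_on K)"

definition has_weak_partial :: "'n \<Rightarrow> (real ^ 'n \<Rightarrow> real) \<Rightarrow> (real ^ 'n \<Rightarrow> real) \<Rightarrow> bool"
  where "has_weak_partial i f g \<longleftrightarrow>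
    locally_integrable f \<and> locally_integrable g \<and>
    (\<forall>\<phi>. test_function \<phi> \<longrightarrow>
      (\<integral>x. f x * partial_deriv i \<phi> x \<partial>lebesgue) = - (\<integral>x. g x * \<phi> x \<partial>lebesgue))"

(* A weak partial derivative is only determined almost everywhere; this picks a representative. *)
definition weak_partial :: "'n \<Rightarrow> (real ^ 'n \<Rightarrow> real) \<Rightarrow> real ^ 'n \<Rightarrow> real"
  where "weak_partial i f = (SOME g. has_weak_partial i f g)"

definition square_integrable :: "(real ^ 'n \<Rightarrow> real) \<Rightarrow> bool"
  where "square_integrable f \<longleftrightarrow>
    f \<in> borel_measurable lebesgue \<and> integrable lebesgue (\<lambda>x. (f x)\<^sup>2)"

(* Elements are representatives, not classes modulo almost-everywhere equality. *)
definition W12 :: "(real ^ 'n \<Rightarrow> real ^ 'm) set"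
  where "W12 = {S. \<forall>j. square_integrable (\<lambda>x. S x $ j) \<and>
    (\<forall>i. \<exists>g. square_integrable g \<and> has_weak_partial i (\<lambda>x. S x $ j) g)}"

definition weak_div :: "(real ^ 'n \<Rightarrow> real ^ 'n) \<Rightarrow> real ^ 'n \<Rightarrow> real"
  where "weak_div S x = (\<Sum>i\<in>UNIV. weak_partial i (\<lambda>z. S z $ i) x)"

definition det2 :: "real ^ 2 \<Rightarrow> real ^ 2 \<Rightarrow> real"
  where "det2 s t = s $ 1 * t $ 2 - s $ 2 * t $ 1"

end

theory Submission
  imports Defs "HOL-Computational_Algebra.Polynomial"
begin

text \<open>
  Write \<open>S = (p, q)\<close>, \<open>T = (r, w)\<close>, \<open>f = div S\<close>, \<open>g = div T\<close>. Multiplying by cutoffs (which perturbs the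
  divergences by a term tending to 0 in the \<open>L\<^sup>1\<close> norm), both fields may be taken compactly supported,
  so that each of \<open>p, q, r, w\<close> is the primitive of the relevant partial derivative along lines.
  Fubini then rewrites the integral of \<open>p w - q r\<close> as a double integral over points \<open>z = (x, y)\<close> and
  \<open>z' = (x', y')\<close>, and since the line integrals of the partial derivatives vanish it equals
  \<open>- \<integral> g F - \<integral> f G - \<integral>\<integral> f(z) g(z') [x' \<le> x] [y \<le> y']\<close>,
  where \<open>F(z')\<close> is the flux of \<open>S\<close> through the ray below \<open>z'\<close> and \<open>G(z)\<close> the flux of \<open>T\<close> through
  the ray to the left of \<open>z\<close>. As \<open>p \<ge> 0\<close>, \<open>F\<close> is nonnegative and at most the flux through the whole line,
  \<open>- \<integral> f(z) [x' \<le> x]\<close>; similarly for \<open>G\<close>. With \<open>A = [x' \<le> x]\<close>, \<open>B = [y \<le> y']\<close> and negative parts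
  \<open>f\<^sup>-\<close>, \<open>g\<^sup>-\<close>, the integrand is therefore bounded by \<open>- A f g\<^sup>- - B f\<^sup>- g - A B f g \<le> f\<^sup>- g\<^sup>-\<close>,
  and the negative parts have integrals \<open>\<integral>\<bar>f\<bar> / 2\<close> and \<open>\<integral>\<bar>g\<bar> / 2\<close>.
\<close>

section \<open>Fubini and coordinate changes on Euclidean products\<close>

text \<open>The obstacle is that the determinant pairs single partial derivatives, whose size the
  divergences do not control. Let \<open>u\<close>, \<open>v\<close> be the diagonal derivatives of
  \<open>S\<close> and \<open>al\<close>, \<open>be\<close> those of \<open>T\<close>, so that f = u
  + v and g = al + be. The determinant contributes \<open>u be\<close> on the pairs with z' to the
  right of and below z, minus \<open>v al\<close> on the pairs with z' to the left and above. The
  double integrals of \<open>u be\<close>, \<open>v be A\<close> and \<open>u al B\<close> vanish,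
  because a factor is integrated along full lines on which the weight is constant. Adding them
  leaves -u g (1-A)B - f be A(1-B) - f g AB, where every term contains f or g. The single derivative
  that survives is integrated over a quadrant, which gives a flux of the component of known sign;
  the sign bounds the flux through a ray by that through its line, and the latter depends on the
  divergence alone. A compactly supported field has total divergence 0, whence the factor 1/2 for
  each negative part. No mollification occurs: testing against products of smooth functions of one
  variable already shows that a truncated component is a.e. the primitive of its weak
  derivative.\<close>

lemma borel_measurable_fst_snd_swap [measurable]:
  "(fst :: 'a::topological_space \<times> 'b::topological_space \<Rightarrow> 'a) \<in> borel \<rightarrow>\<^sub>M borel"
  "(snd :: 'a \<times> 'b \<Rightarrow> 'b) \<in> borel \<rightarrow>\<^sub>M borel"
  "(prod.swap :: 'a \<times> 'b \<Rightarrow> 'b \<times> 'a) \<in> borel \<rightarrow>\<^sub>M borel"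
  by (intro borel_measurable_continuous_onI; auto intro!: continuous_intros simp: prod.swap_def)+

lemma integrable_lborel_Fubini:
  fixes h :: "'a::euclidean_space \<times> 'b::euclidean_space \<Rightarrow> real"
  assumes "integrable lborel h"
  shows "(\<integral>x. (\<integral>y. h (x, y) \<partial>lborel) \<partial>lborel) = integral\<^sup>L lborel h"
    and "(\<integral>y. (\<integral>x. h (x, y) \<partial>lborel) \<partial>lborel) = integral\<^sup>L lborel h"
    and "AE x in lborel. integrable lborel (\<lambda>y. h (x, y))"
    and "AE y in lborel. integrable lborel (\<lambda>x. h (x, y))"
    and "integrable lborel (\<lambda>x. \<integral>y. h (x, y) \<partial>lborel)"
    and "integrable lborel (\<lambda>y. \<integral>x. h (x, y) \<partial>lborel)"
  using lborel_pair.integral_fst'[of h] lborel_pair.integral_snd[of "\<lambda>x y. h (x, y)"]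
    lborel_pair.AE_integrable_fst'[of h] lborel_pair.AE_integrable_snd[of "\<lambda>x y. h (x, y)"]
    lborel_pair.integrable_fst'[of h] lborel_pair.integrable_snd[of "\<lambda>x y. h (x, y)"] assms
  by (auto simp: lborel_prod)

lemma AE_lborel_pair_iff:
  fixes P :: "'a::euclidean_space \<Rightarrow> 'b::euclidean_space \<Rightarrow> bool"
  assumes "Measurable.pred borel (\<lambda>z. P (fst z) (snd z))"
  shows "(AE z in lborel. P (fst z) (snd z)) \<longleftrightarrow> (AE x in lborel. AE y in lborel. P x y)"
    and "(AE z in lborel. P (fst z) (snd z)) \<longleftrightarrow> (AE y in lborel. AE x in lborel. P x y)"
proof -
  have m: "{z \<in> space (lborel \<Otimes>\<^sub>M lborel). P (fst z) (snd z)} \<in> sets (lborel \<Otimes>\<^sub>M lborel)"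
    using assms unfolding lborel_prod by (simp add: pred_def)
  show 1: "(AE z in lborel. P (fst z) (snd z)) \<longleftrightarrow> (AE x in lborel. AE y in lborel. P x y)"
    using lborel_pair.AE_pair_iff[OF m] unfolding lborel_prod by simp
  show "(AE z in lborel. P (fst z) (snd z)) \<longleftrightarrow> (AE y in lborel. AE x in lborel. P x y)"
    unfolding 1 using lborel_pair.AE_commute[OF m] .
qed

lemma distr_lborel_swap:
  "distr lborel borel prod.swap = (lborel :: ('a::euclidean_space \<times> 'b::euclidean_space) measure)"
proof -
  have "distr lborel borel prod.swap = distr (lborel \<Otimes>\<^sub>M lborel) (lborel \<Otimes>\<^sub>M lborel)
      (\<lambda>(x, y). (y, x) :: 'a \<times> 'b)"
    unfolding lborel_prod by (rule distr_cong) auto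
  also have "\<dots> = lborel"
    unfolding lborel_pair.distr_pair_swap[symmetric] by (rule lborel_prod)
  finally show ?thesis .
qed

lemma integral_lborel_swap:
  fixes h :: "'a::euclidean_space \<times> 'b::euclidean_space \<Rightarrow> real"
  assumes "h \<in> borel_measurable borel"
  shows "(\<integral>z. h (prod.swap z) \<partial>lborel) = integral\<^sup>L lborel h"
  and "integrable lborel (\<lambda>z. h (prod.swap z)) \<longleftrightarrow> integrable lborel h"
proof -
  show "(\<integral>z. h (prod.swap z) \<partial>lborel) = integral\<^sup>L lborel h"
   "integrable lborel (\<lambda>z. h (prod.swap z)) \<longleftrightarrow> integrable lborel h"
    using assms integral_distr[of prod.swap lborel borel h] integrable_distr_eq[of prod.swap lborel borel h] 
    by (auto simp: distr_lborel_swap)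
qed

lemma AE_lborel_swap:
  fixes P :: "'a::euclidean_space \<times> 'b::euclidean_space \<Rightarrow> bool"
  assumes "AE z in lborel. P z"
  shows "AE z in lborel. P (prod.swap z)"
proof -
  have "AE z in distr lborel borel (prod.swap :: 'b \<times> 'a \<Rightarrow> _). P z"
    unfolding distr_lborel_swap by (rule assms)
  then show ?thesis
    by (intro AE_distrD[of prod.swap lborel borel P]) auto
qed

lemma integrable_lborel_tensor:
  fixes a :: "'a::euclidean_space \<Rightarrow> real" and b :: "'b::euclidean_space \<Rightarrow> real"
  assumes a: "integrable lborel a" and b: "integrable lborel b"
  shows "integrable lborel (\<lambda>z. a (fst z) * b (snd z))"
proof -
  have [measurable]: "a \<in> borel_measurable borel" "b \<in> borel_measurable borel"
    using a b by (auto dest: borel_measurable_integrable)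
  have "integrable (lborel \<Otimes>\<^sub>M lborel) (\<lambda>z. a (fst z) * b (snd z))"
    using a b by (intro lborel_pair.Fubini_integrable) (auto simp: abs_mult)
  then show ?thesis by (simp add: lborel_prod)
qed

lemma AE_lborel_fst_snd:
  assumes "AE x in lborel. P x"
  shows "AE z in (lborel :: ('a::euclidean_space \<times> 'b::euclidean_space) measure). P (fst z)"
    and "AE z in (lborel :: ('b \<times> 'a) measure). P (snd z)"
proof -
  \<comment> \<open>\<open>P\<close> need not be measurable, so its failures are first covered by a
    Borel null set.\<close>
  obtain N where N: "{x. \<not> P x} \<subseteq> N" "N \<in> null_sets lborel"
    using assms by (auto simp: eventually_ae_filter)
  have [measurable]: "N \<in> sets borel" using N by auto
  have AEN: "AE x in lborel. x \<notin> N" using N by (auto intro: AE_not_in)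
  have "AE z in (lborel :: ('a \<times> 'b) measure). fst z \<notin> N"
    by (subst AE_lborel_pair_iff(2)[of "\<lambda>x y. x \<notin> N"]) (use AEN in auto)
  then show "AE z in (lborel :: ('a \<times> 'b) measure). P (fst z)"
    by eventually_elim (use N in auto)
  have "AE z in (lborel :: ('b \<times> 'a) measure). snd z \<notin> N"
    by (subst AE_lborel_pair_iff(1)[of "\<lambda>x y. y \<notin> N"]) (use AEN in auto)
  then show "AE z in (lborel :: ('b \<times> 'a) measure). P (snd z)"
    by eventually_elim (use N in auto)
qed

text \<open>A permutation of coordinates maps boxes to boxes with the same side lengths. This one
  sends ((x, y), (s, t)) to ((s, y), (x, t)): a point together with two integration variables, one
  along each axis, becomes a pair of points of the plane.\<close>

lemma distr_lborel_exchange: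
  "distr lborel borel (\<lambda>z. ((fst (snd z), snd (fst z)), (fst (fst z), snd (snd z)))) =
    (lborel :: ((real \<times> real) \<times> (real \<times> real)) measure)" (is "distr _ _ ?\<pi> = _")
proof (rule lborel_eqI[symmetric])
  fix l u :: "(real \<times> real) \<times> (real \<times> real)"
  assume le: "\<And>b. b \<in> Basis \<Longrightarrow> l \<bullet> b \<le> u \<bullet> b"
  have m: "?\<pi> \<in> borel_measurable borel"
    by (intro borel_measurable_continuous_onI continuous_intros)
  have "?\<pi> -` box l u = box (?\<pi> l) (?\<pi> u)"
    by (cases l; cases u) (auto simp: box_def Basis_prod_def inner_prod_def)
  then have "emeasure (distr lborel borel ?\<pi>) (box l u) = emeasure lborel (box (?\<pi> l) (?\<pi> u))"
    using m by (simp add: emeasure_distr)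
  also have "\<dots> = (\<Prod>b\<in>Basis. (?\<pi> u - ?\<pi> l) \<bullet> b)"
  proof (rule emeasure_lborel_box)
    have "fst (fst l) \<le> fst (fst u)" "snd (fst l) \<le> snd (fst u)"
         "fst (snd l) \<le> fst (snd u)" "snd (snd l) \<le> snd (snd u)"
      using le[of "((1, 0), 0)"] le[of "((0, 1), 0)"] le[of "(0, (1, 0))"] le[of "(0, (0, 1))"]
      by (auto simp: Basis_prod_def inner_prod_def)
    then show "?\<pi> l \<bullet> b \<le> ?\<pi> u \<bullet> b" if "b \<in> Basis" for b
      using that by (auto simp: Basis_prod_def inner_prod_def)
  qed
  also have "(\<Prod>b\<in>Basis. (?\<pi> u - ?\<pi> l) \<bullet> b) = (\<Prod>b\<in>Basis. (u - l) \<bullet> b)"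
    by (simp add: Basis_prod_def inner_prod_def zero_prod_def)
  finally show "emeasure (distr lborel borel ?\<pi>) (box l u) = (\<Prod>b\<in>Basis. (u - l) \<bullet> b)" .
qed simp

section \<open>The inequality for functions given as primitives\<close>

text \<open>Real-valued, so that products describe quadrants. Since
  \<open>lt x y + le y x = 1\<close>, mixing the strict and the weak version splits all pairs of
  points into quadrants with no overlap on the boundary.\<close>

definition lt :: "real \<Rightarrow> real \<Rightarrow> real" where "lt x y = (if x < y then 1 else 0)"
definition le :: "real \<Rightarrow> real \<Rightarrow> real" where "le x y = (if x \<le> y then 1 else 0)"

lemma measurable_lt [measurable (raw)]:
  assumes [measurable]: "f \<in> borel_measurable M" "g \<in> borel_measurable M"
  shows "(\<lambda>x. lt (f x) (g x)) \<in> borel_measurable M"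
  unfolding lt_def by measurable

lemma measurable_le [measurable (raw)]:
  assumes [measurable]: "f \<in> borel_measurable M" "g \<in> borel_measurable M"
  shows "(\<lambda>x. le (f x) (g x)) \<in> borel_measurable M"
  unfolding le_def by measurable

lemma lt_le_bounds [simp]: "\<bar>lt x y\<bar> \<le> 1" "\<bar>le x y\<bar> \<le> 1" "0 \<le> lt x y" "0 \<le> le x y" "lt x y \<le> 1" "le x y \<le> 1"
  by (auto simp: lt_def le_def)

lemma integrable_mult_bounded1:
  fixes h c :: "'a \<Rightarrow> real"
  assumes "integrable M h" "c \<in> borel_measurable M" "\<And>x. \<bar>c x\<bar> \<le> 1"
  shows "integrable M (\<lambda>x. h x * c x)"
  using assms by (intro Bochner_Integration.integrable_bound[OF assms(1)])
    (auto simp: abs_mult mult_left_le)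

lemma borel_measurable_app2:
  fixes c :: "real \<Rightarrow> real \<Rightarrow> real"
  assumes c: "(\<lambda>z. c (fst z) (snd z)) \<in> borel_measurable borel"
    and "f \<in> borel_measurable M" "g \<in> borel_measurable M"
  shows "(\<lambda>x. c (f x) (g x)) \<in> borel_measurable M"
  using measurable_compose[OF borel_measurable_Pair[OF assms(2,3)] c] by simp

text \<open>At (x, y) the product is the integral over (s, t) of A(s, y) B(x, t) with kernel
  weights, and the exchange of first coordinates makes (s, y) and (x, t) two independent points.
  Hence the product is integrable as soon as \<open>A\<close> and \<open>B\<close> are, although
  \<open>a\<close> and \<open>b\<close> need not be integrable themselves. The kernels are left
  general in order to cover \<open>lt\<close>, \<open>le\<close> and the constant 1.\<close>

lemma integral_primitives_mult:
  fixes A B :: "real \<times> real \<Rightarrow> real" and c d :: "real \<Rightarrow> real \<Rightarrow> real"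
  assumes A: "integrable lborel A" and B: "integrable lborel B"
    and c [measurable]: "(\<lambda>z. c (fst z) (snd z)) \<in> borel_measurable borel" and c1: "\<And>x y. \<bar>c x y\<bar> \<le> 1"
    and d [measurable]: "(\<lambda>z. d (fst z) (snd z)) \<in> borel_measurable borel" and d1: "\<And>x y. \<bar>d x y\<bar> \<le> 1"
  defines "a \<equiv> \<lambda>z. \<integral>s. A (s, snd z) * c s (fst z) \<partial>lborel"
    and "b \<equiv> \<lambda>z. \<integral>t. B (fst z, t) * d t (snd z) \<partial>lborel"
  shows "integrable lborel (\<lambda>z. a z * b z)"
    and "(\<integral>z. a z * b z \<partial>lborel) = (\<integral>Z. A (fst Z) * B (snd Z) *
      (c (fst (fst Z)) (fst (snd Z)) * d (snd (snd Z)) (snd (fst Z))) \<partial>lborel)"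
proof -
  let ?\<pi> = "\<lambda>z::(real \<times> real) \<times> (real \<times> real). ((fst (snd z), snd (fst z)), (fst (fst z), snd (snd z)))"
  define H where "H = (\<lambda>Z::(real \<times> real) \<times> (real \<times> real). A (fst Z) * B (snd Z) *
      (c (fst (fst Z)) (fst (snd Z)) * d (snd (snd Z)) (snd (fst Z))))"
  have [measurable]: "A \<in> borel_measurable borel" "B \<in> borel_measurable borel"
    using A B by (auto dest: borel_measurable_integrable)
  have H: "integrable lborel H"
    unfolding H_def
    by (intro integrable_mult_bounded1 integrable_lborel_tensor A B)
      (auto intro!: borel_measurable_app2[OF c] borel_measurable_app2[OF d] borel_measurable_times simp: abs_mult c1 d1 mult_le_one)
  have m: "?\<pi> \<in> borel_measurable borel"
    by (intro borel_measurable_continuous_onI continuous_intros)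
  have mH: "H \<in> borel_measurable borel"
    using H by (auto dest: borel_measurable_integrable)
  have H\<pi>: "integrable lborel (\<lambda>Z. H (?\<pi> Z))"
    using integrable_distr_eq[of ?\<pi> lborel borel H] m mH H by (simp add: distr_lborel_exchange)
  have e: "integral\<^sup>L lborel H = (\<integral>Z. H (?\<pi> Z) \<partial>lborel)"
    using integral_distr[of ?\<pi> lborel borel H] m mH by (simp add: distr_lborel_exchange)
  have AEa: "AE z in lborel. integrable lborel (\<lambda>s. A (s, snd z))"
    by (rule AE_lborel_fst_snd(2)[OF integrable_lborel_Fubini(4)[OF A]])
  have AEb: "AE z in lborel. integrable lborel (\<lambda>t. B (fst z, t))"
    by (rule AE_lborel_fst_snd(1)[OF integrable_lborel_Fubini(3)[OF B]])
  have inner: "AE z in lborel. (\<integral>w. H (?\<pi> (z, w)) \<partial>lborel) = a z * b z"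
    using AEa AEb
  proof eventually_elim
    case (elim z)
    have m1: "(\<lambda>s. c s (fst z)) \<in> borel_measurable lborel" "(\<lambda>t. d t (snd z)) \<in> borel_measurable lborel"
      using measurable_compose[OF _ c, of "\<lambda>s. (s, fst z)" borel]  measurable_compose[OF _ d, of "\<lambda>s. (s, snd z)" borel]
      by auto
    have "(\<integral>w. H (?\<pi> (z, w)) \<partial>lborel) =
        (\<integral>w. (A (fst w, snd z) * c (fst w) (fst z)) * (B (fst z, snd w) * d (snd w) (snd z)) \<partial>lborel)"
      by (simp add: H_def mult_ac)
    also have "\<dots> = (\<integral>s. \<integral>t. (A (s, snd z) * c s (fst z)) * (B (fst z, t) * d t (snd z)) \<partial>lborel \<partial>lborel)"
      using integrable_lborel_Fubini(1)[OF integrable_lborel_tensor[OF 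
         integrable_mult_bounded1[OF elim(1) m1(1)] integrable_mult_bounded1[OF elim(2) m1(2)]]] c1 d1 by simp
    also have "\<dots> = a z * b z" by (simp add: a_def b_def)
    finally show ?case .
  qed
  have Am: "A \<in> borel_measurable (borel \<Otimes>\<^sub>M borel)" "B \<in> borel_measurable (borel \<Otimes>\<^sub>M borel)"
    by (simp_all add: borel_prod)
  have "(\<lambda>z. \<integral>s. A (s, snd z) * c s (fst z) \<partial>lborel) \<in> borel_measurable (borel \<Otimes>\<^sub>M borel)"
  proof (rule lborel.borel_measurable_lebesgue_integral)
    have "(\<lambda>p. A (snd p, snd (fst p))) \<in> borel_measurable ((borel \<Otimes>\<^sub>M borel) \<Otimes>\<^sub>M lborel)"
      by (rule measurable_compose[OF _ Am(1)]) measurable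
    moreover have "(\<lambda>p. c (snd p) (fst (fst p))) \<in> borel_measurable ((borel \<Otimes>\<^sub>M borel) \<Otimes>\<^sub>M lborel)"
      by (rule borel_measurable_app2[OF c]) measurable
    ultimately show "(\<lambda>(z, s). A (s, snd z) * c s (fst z)) \<in> borel_measurable ((borel \<Otimes>\<^sub>M borel) \<Otimes>\<^sub>M lborel)"
      unfolding split_beta by (rule borel_measurable_times)
  qed
  then have am: "a \<in> borel_measurable borel" by (simp add: a_def borel_prod)
  have "(\<lambda>z. \<integral>t. B (fst z, t) * d t (snd z) \<partial>lborel) \<in> borel_measurable (borel \<Otimes>\<^sub>M borel)"
  proof (rule lborel.borel_measurable_lebesgue_integral)
    have "(\<lambda>p. B (fst (fst p), snd p)) \<in> borel_measurable ((borel \<Otimes>\<^sub>M borel) \<Otimes>\<^sub>M lborel)"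
      by (rule measurable_compose[OF _ Am(2)]) measurable
    moreover have "(\<lambda>p. d (snd p) (snd (fst p))) \<in> borel_measurable ((borel \<Otimes>\<^sub>M borel) \<Otimes>\<^sub>M lborel)"
      by (rule borel_measurable_app2[OF d]) measurable
    ultimately show "(\<lambda>(z, t). B (fst z, t) * d t (snd z)) \<in> borel_measurable ((borel \<Otimes>\<^sub>M borel) \<Otimes>\<^sub>M lborel)"
      unfolding split_beta by (rule borel_measurable_times)
  qed
  then have bm: "b \<in> borel_measurable borel" by (simp add: b_def borel_prod)
  have I: "integrable lborel (\<lambda>z. \<integral>w. H (?\<pi> (z, w)) \<partial>lborel)"
    by (rule integrable_lborel_Fubini(5)[OF H\<pi>])
  have ab: "(\<lambda>z. a z * b z) \<in> borel_measurable lborel"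
    using am bm by simp
  show "integrable lborel (\<lambda>z. a z * b z)"
    using integrable_cong_AE_imp[OF I ab] inner by (auto simp: eq_commute)
  have "(\<integral>z. a z * b z \<partial>lborel) = (\<integral>z. \<integral>w. H (?\<pi> (z, w)) \<partial>lborel \<partial>lborel)"
    by (rule integral_cong_AE[OF ab borel_measurable_integrable[OF I]]) (use inner in auto)
  also have "\<dots> = integral\<^sup>L lborel H"
    unfolding e by (rule integrable_lborel_Fubini(1)[OF H\<pi>])
  finally show "(\<integral>z. a z * b z \<partial>lborel) = (\<integral>Z. A (fst Z) * B (snd Z) *
      (c (fst (fst Z)) (fst (snd Z)) * d (snd (snd Z)) (snd (fst Z))) \<partial>lborel)"
    by (simp add: H_def)
qed

text \<open>The weight is constant on each vertical line, so it leaves the inner integral, which is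
  0.\<close>

lemma integral_mult_const_fibre:
  fixes v :: "real \<times> real \<Rightarrow> real"
  assumes v: "integrable lborel v" and v0: "AE x in lborel. (\<integral>t. v (x, t) \<partial>lborel) = 0"
    and c: "c \<in> borel_measurable borel" "\<And>x. \<bar>c x\<bar> \<le> 1"
  shows "(\<integral>z. v z * c (fst z) \<partial>lborel) = 0"
proof -
  have cm: "(\<lambda>z::real \<times> real. c (fst z)) \<in> borel_measurable lborel"
    using measurable_compose[OF _ c(1), of "fst :: real \<times> real \<Rightarrow> real" borel]
      borel_measurable_continuous_onI[of "fst :: real \<times> real \<Rightarrow> real"] by (simp add: continuous_on_fst)
  have "(\<integral>z. v z * c (fst z) \<partial>lborel) = (\<integral>x. \<integral>t. v (x, t) * c x \<partial>lborel \<partial>lborel)"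
    using integrable_lborel_Fubini(1)[OF integrable_mult_bounded1[OF v cm c(2)]] by simp
  also have "\<dots> = (\<integral>x. (\<integral>t. v (x, t) \<partial>lborel) * c x \<partial>lborel)"
    by simp
  also have "\<dots> = 0"
    by (rule integral_eq_zero_AE) (use v0 in auto)
  finally show ?thesis .
qed

text \<open>
  With \<open>c = le\<close> the middle integral is the flux of a field with first component \<open>\<integral>s<x.
  u\<close> through the vertical ray below \<open>(x, y)\<close>; the upper bound is the flux through the whole
  vertical line, i.e. minus the divergence mass to its right.
\<close>

lemma mass_below_bounds:
  fixes u v :: "real \<times> real \<Rightarrow> real" and c :: "real \<Rightarrow> real \<Rightarrow> real"
  assumes u: "integrable lborel u" and v: "integrable lborel v"
    and u0: "AE y in lborel. (\<integral>s. u (s, y) \<partial>lborel) = 0"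
    and v0: "AE x in lborel. (\<integral>t. v (x, t) \<partial>lborel) = 0"
    and P: "AE z in lborel. 0 \<le> (\<integral>s. u (s, snd z) * lt s (fst z) \<partial>lborel)"
    and c: "(\<lambda>z. c (fst z) (snd z)) \<in> borel_measurable borel" "\<And>x y. 0 \<le> c x y" "\<And>x y. c x y \<le> 1"
  shows "AE x in lborel. \<forall>y. 0 \<le> (\<integral>z. u z * (lt (fst z) x * c (snd z) y) \<partial>lborel)
     \<and> (\<integral>z. u z * (lt (fst z) x * c (snd z) y) \<partial>lborel) \<le> - (\<integral>z. (u z + v z) * le x (fst z) \<partial>lborel)"
proof -
  have [measurable]: "u \<in> borel_measurable borel"
    using u by (auto dest: borel_measurable_integrable)
  have Am: "u \<in> borel_measurable (borel \<Otimes>\<^sub>M borel)"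
    by (simp_all add: borel_prod)
  have "(\<lambda>z. \<integral>s. u (s, snd z) * lt s (fst z) \<partial>lborel) \<in> borel_measurable (borel \<Otimes>\<^sub>M borel)"
  proof (rule lborel.borel_measurable_lebesgue_integral)
    have "(\<lambda>p. u (snd p, snd (fst p))) \<in> borel_measurable ((borel \<Otimes>\<^sub>M borel) \<Otimes>\<^sub>M lborel)"
      by (rule measurable_compose[OF _ Am]) measurable
    moreover have "(\<lambda>p. lt (snd p) (fst (fst p))) \<in> borel_measurable ((borel \<Otimes>\<^sub>M borel) \<Otimes>\<^sub>M lborel)"
      by measurable
    ultimately show "(\<lambda>(z, s). u (s, snd z) * lt s (fst z)) \<in> borel_measurable ((borel \<Otimes>\<^sub>M borel) \<Otimes>\<^sub>M lborel)"
      unfolding split_beta by (rule borel_measurable_times)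
  qed
  then have pm: "(\<lambda>z. \<integral>s. u (s, snd z) * lt s (fst z) \<partial>lborel) \<in> borel_measurable borel"
    by (simp add: borel_prod)
  have P': "AE x in lborel. AE y in lborel. 0 \<le> (\<integral>s. u (s, y) * lt s x \<partial>lborel)"
    by (subst AE_lborel_pair_iff(1)[symmetric]) (use P pm in auto)
  \<comment> \<open>The weight depends on the first coordinate only, so \<open>v\<close> contributes
    nothing and the flux of the first component may be written with the full divergence. As the
    total mass of \<open>u + v\<close> is 0, the mass to the left of \<open>x\<close> is minus the
    mass to its right.\<close>
  have ucu: "(\<integral>z. (u z + v z) * lt (fst z) x \<partial>lborel) = (\<integral>z. u z * lt (fst z) x \<partial>lborel)"
    "(\<integral>z. (u z + v z) * lt (fst z) x \<partial>lborel) = - (\<integral>z. (u z + v z) * le x (fst z) \<partial>lborel)" for x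
  proof -
    have i: "integrable lborel (\<lambda>z. u z * lt (fst z) x)" "integrable lborel (\<lambda>z. v z * lt (fst z) x)"
        "integrable lborel (\<lambda>z. u z * le x (fst z))" "integrable lborel (\<lambda>z. v z * le x (fst z))"
      by (intro integrable_mult_bounded1 u v; simp)+
    have v1: "(\<integral>z. v z * lt (fst z) x \<partial>lborel) = 0" 
      using integral_mult_const_fibre[OF v v0, of "\<lambda>s. lt s x"] by simp
    show "(\<integral>z. (u z + v z) * lt (fst z) x \<partial>lborel) = (\<integral>z. u z * lt (fst z) x \<partial>lborel)"
      using i v1 by (simp add: distrib_right)
    have "(\<integral>z. (u z + v z) * lt (fst z) x \<partial>lborel) + (\<integral>z. (u z + v z) * le x (fst z) \<partial>lborel)
        = (\<integral>z. (u z + v z) * lt (fst z) x + (u z + v z) * le x (fst z) \<partial>lborel)"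
      using i by (subst Bochner_Integration.integral_add) (auto simp: distrib_right)
    also have "\<dots> = (\<integral>z. u z + v z \<partial>lborel)"
      by (rule Bochner_Integration.integral_cong) (auto simp: lt_def le_def)
    also have "\<dots> = 0"
    proof -
      have "(\<integral>z. u z \<partial>lborel) = 0"
        using u0 by (subst integrable_lborel_Fubini(2)[OF u, symmetric]) (rule integral_eq_zero_AE)
      moreover have "(\<integral>z. v z \<partial>lborel) = 0"
        using v0 by (subst integrable_lborel_Fubini(1)[OF v, symmetric]) (rule integral_eq_zero_AE)
      ultimately show ?thesis using u v by simp
    qed
    finally show "(\<integral>z. (u z + v z) * lt (fst z) x \<partial>lborel) = - (\<integral>z. (u z + v z) * le x (fst z) \<partial>lborel)"
      by linarith
  qed
  \<comment> \<open>The exceptional set depends on \<open>x\<close> alone, because the fibrewise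
    sign is used for almost every height and the weight \<open>c\<close> only has to lie in [0, 1].
    This is what allows all \<open>y\<close> at once, in particular the height of the same point
    later.\<close>
  show ?thesis
    using P'
  proof eventually_elim
    case (elim x)
    show ?case
    proof
      fix y
      have cm: "(\<lambda>z. c (snd z) y) \<in> borel_measurable (borel :: (real \<times> real) measure)" "(\<lambda>t. c t y) \<in> borel_measurable borel"
        by (intro borel_measurable_app2[OF c(1)]; simp)+
      have j: "integrable lborel (\<lambda>z. u z * lt (fst z) x)"
        by (intro integrable_mult_bounded1 u; simp)
      have i: "integrable lborel (\<lambda>z. u z * (lt (fst z) x * c (snd z) y))"
        using cm c(2,3) by (intro integrable_mult_bounded1 u) (auto simp: abs_mult mult_le_one)
      have "(\<integral>z. u z * (lt (fst z) x * c (snd z) y) \<partial>lborel) =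
         (\<integral>t. \<integral>s. u (s, t) * (lt s x * c t y) \<partial>lborel \<partial>lborel)"
        using integrable_lborel_Fubini(2)[OF i] by simp
      also have "\<dots> = (\<integral>t. (\<integral>s. u (s, t) * lt s x \<partial>lborel) * c t y \<partial>lborel)"
        by (simp add: mult.assoc[symmetric])
      finally have e: "(\<integral>z. u z * (lt (fst z) x * c (snd z) y) \<partial>lborel) = \<dots>" .
      have "0 \<le> (\<integral>t. (\<integral>s. u (s, t) * lt s x \<partial>lborel) * c t y \<partial>lborel)"
        by (rule integral_nonneg_AE) (use elim c(2) in auto)
      moreover have "(\<integral>t. (\<integral>s. u (s, t) * lt s x \<partial>lborel) * c t y \<partial>lborel)
          \<le> (\<integral>t. (\<integral>s. u (s, t) * lt s x \<partial>lborel) \<partial>lborel)"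
      proof (rule integral_mono_AE)
        show "integrable lborel (\<lambda>t. (\<integral>s. u (s, t) * lt s x \<partial>lborel))"
          using integrable_lborel_Fubini(6)[OF j] by simp
        then show "integrable lborel (\<lambda>t. (\<integral>s. u (s, t) * lt s x \<partial>lborel) * c t y)"
          using cm c(2,3) by (intro integrable_mult_bounded1) auto
        show "AE t in lborel. (\<integral>s. u (s, t) * lt s x \<partial>lborel) * c t y \<le> (\<integral>s. u (s, t) * lt s x \<partial>lborel)"
          using elim by eventually_elim (use c(2,3) in \<open>simp add: mult_left_le\<close>)
      qed
      moreover have "(\<integral>t. (\<integral>s. u (s, t) * lt s x \<partial>lborel) \<partial>lborel) = (\<integral>z. u z * lt (fst z) x \<partial>lborel)"
        using integrable_lborel_Fubini(2)[OF j] by simp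
      ultimately show "0 \<le> (\<integral>z. u z * (lt (fst z) x * c (snd z) y) \<partial>lborel)
       \<and> (\<integral>z. u z * (lt (fst z) x * c (snd z) y) \<partial>lborel) \<le> - (\<integral>z. (u z + v z) * le x (fst z) \<partial>lborel)"
        unfolding e using ucu[of x] by auto
    qed
  qed
qed

text \<open>The core estimate. The functions \<open>u\<close> and \<open>v\<close> play the diagonal
  derivatives of the first field, \<open>al\<close> and \<open>be\<close> those of the second;
  compact support enters only through the vanishing line integrals. The term \<open>q r\<close> is
  expressed with \<open>le\<close> instead of \<open>lt\<close>, so that its quadrant fits the
  partition by \<open>lt\<close> and \<open>le\<close>.\<close>

lemma integral_det_le_neg_parts:
  fixes u v al be :: "real \<times> real \<Rightarrow> real"
  assumes u: "integrable lborel u" and v: "integrable lborel v"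
    and al: "integrable lborel al" and be: "integrable lborel be"
    and u0: "AE y in lborel. (\<integral>s. u (s, y) \<partial>lborel) = 0"
    and v0: "AE x in lborel. (\<integral>t. v (x, t) \<partial>lborel) = 0"
    and al0: "AE y in lborel. (\<integral>s. al (s, y) \<partial>lborel) = 0"
    and be0: "AE x in lborel. (\<integral>t. be (x, t) \<partial>lborel) = 0"
    and P: "AE z in lborel. 0 \<le> (\<integral>s. u (s, snd z) * lt s (fst z) \<partial>lborel)"
    and W: "AE z in lborel. 0 \<le> (\<integral>t. be (fst z, t) * lt t (snd z) \<partial>lborel)"
  shows "(\<integral>z. (\<integral>s. u (s, snd z) * lt s (fst z) \<partial>lborel) * (\<integral>t. be (fst z, t) * lt t (snd z) \<partial>lborel)
     - (\<integral>s. al (s, snd z) * le s (fst z) \<partial>lborel) * (\<integral>t. v (fst z, t) * le t (snd z) \<partial>lborel) \<partial>lborel)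
     \<le> (\<integral>z. max 0 (- (u z + v z)) \<partial>lborel) * (\<integral>z. max 0 (- (al z + be z)) \<partial>lborel)"
proof -
  define f where "f = (\<lambda>z. u z + v z)"
  define g where "g = (\<lambda>z. al z + be z)"
  have f: "integrable lborel f" and g: "integrable lborel g"
    using u v al be by (auto simp: f_def g_def)
  have fm: "integrable lborel (\<lambda>z. max 0 (- f z))" and gm: "integrable lborel (\<lambda>z. max 0 (- g z))"
    using f g by auto
  have [measurable]: "u \<in> borel_measurable borel" "v \<in> borel_measurable borel"
    "al \<in> borel_measurable borel" "be \<in> borel_measurable borel"
    using u v al be by (auto dest: borel_measurable_integrable)
  have bm: "(\<lambda>z. lt (fst z) (snd z)) \<in> borel_measurable borel" "(\<lambda>z. le (fst z) (snd z)) \<in> borel_measurable borel"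
    "(\<lambda>z. le (snd z) (fst z)) \<in> borel_measurable borel" 
    by measurable
  let ?x = "\<lambda>Z::(real \<times> real) \<times> (real \<times> real). fst (fst Z)" 
  let ?y = "\<lambda>Z::(real \<times> real) \<times> (real \<times> real). snd (fst Z)" 
  let ?x' = "\<lambda>Z::(real \<times> real) \<times> (real \<times> real). fst (snd Z)" 
  let ?y' = "\<lambda>Z::(real \<times> real) \<times> (real \<times> real). snd (snd Z)" 
  have int: "integrable lborel (\<lambda>Z. a (fst Z) * b (snd Z) * c Z)"
    if "integrable lborel a" "integrable lborel b" "c \<in> borel_measurable borel" "\<And>Z. \<bar>c Z\<bar> \<le> 1"
    for a b :: "real \<times> real \<Rightarrow> real" and c :: "(real \<times> real) \<times> (real \<times> real) \<Rightarrow> real"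
    by (intro integrable_mult_bounded1 integrable_lborel_tensor) (use that in auto)
  have prod1: "\<bar>a * b\<bar> \<le> 1" if "\<bar>a\<bar> \<le> 1" "\<bar>b\<bar> \<le> 1" for a b :: real
    using that by (simp add: abs_mult mult_le_one)
  \<comment> \<open>With A = [x' \<le> x] and B = [y \<le> y'] these are (1-A)B, A(1-B), AB and
    (1-A)(1-B); they add up to 1.\<close>
  define ux where "ux = (\<lambda>Z. lt (?x Z) (?x' Z) * le (?y Z) (?y' Z))"
  define uy where "uy = (\<lambda>Z. le (?x' Z) (?x Z) * lt (?y' Z) (?y Z))"
  define ul where "ul = (\<lambda>Z. le (?x' Z) (?x Z) * le (?y Z) (?y' Z))"
  define lr where "lr = (\<lambda>Z. lt (?x Z) (?x' Z) * lt (?y' Z) (?y Z))"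
  have cm [measurable]: "ux \<in> borel_measurable borel" "uy \<in> borel_measurable borel"
     "ul \<in> borel_measurable borel" "lr \<in> borel_measurable borel"
    unfolding ux_def uy_def ul_def lr_def by measurable
  have c1: "\<And>Z. \<bar>ux Z\<bar> \<le> 1" "\<And>Z. \<bar>uy Z\<bar> \<le> 1" "\<And>Z. \<bar>ul Z\<bar> \<le> 1" "\<And>Z. \<bar>lr Z\<bar> \<le> 1"
    unfolding ux_def uy_def ul_def lr_def by (intro prod1; simp)+
  note int' = int[OF _ _ cm(1) c1(1)] int[OF _ _ cm(2) c1(2)] int[OF _ _ cm(3) c1(3)] int[OF _ _ cm(4) c1(4)]
  let ?I = "\<lambda>a b c. \<integral>Z. a (fst Z) * b (snd Z) * c Z \<partial>lborel"

  have 1: "integrable lborel (\<lambda>z. (\<integral>s. u (s, snd z) * lt s (fst z) \<partial>lborel) * (\<integral>t. be (fst z, t) * lt t (snd z) \<partial>lborel))"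
    "(\<integral>z. (\<integral>s. u (s, snd z) * lt s (fst z) \<partial>lborel) * (\<integral>t. be (fst z, t) * lt t (snd z) \<partial>lborel) \<partial>lborel) = ?I u be lr"
    using integral_primitives_mult[OF u be bm(1) _ bm(1)] by (simp_all add: lr_def)
  have 2: "integrable lborel (\<lambda>z. (\<integral>s. al (s, snd z) * le s (fst z) \<partial>lborel) * (\<integral>t. v (fst z, t) * le t (snd z) \<partial>lborel))"
    "(\<integral>z. (\<integral>s. al (s, snd z) * le s (fst z) \<partial>lborel) * (\<integral>t. v (fst z, t) * le t (snd z) \<partial>lborel) \<partial>lborel) = ?I v al ul"
  proof -
    show "integrable lborel (\<lambda>z. (\<integral>s. al (s, snd z) * le s (fst z) \<partial>lborel) * (\<integral>t. v (fst z, t) * le t (snd z) \<partial>lborel))"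
      using integral_primitives_mult(1)[OF al v bm(2) _ bm(2)] by simp
    have "(\<integral>z. (\<integral>s. al (s, snd z) * le s (fst z) \<partial>lborel) * (\<integral>t. v (fst z, t) * le t (snd z) \<partial>lborel) \<partial>lborel) = 
       (\<integral>Z. al (fst Z) * v (snd Z) * (le (?x Z) (?x' Z) * le (?y' Z) (?y Z)) \<partial>lborel)"
      using integral_primitives_mult(2)[OF al v bm(2) _ bm(2)] by simp
    \<comment> \<open>The two points are exchanged, so that in both terms the derivative of the
      first field sits at the first point.\<close>
    also have "\<dots> = (\<integral>Z. v (fst (prod.swap Z)) * al (snd (prod.swap Z)) * ul (prod.swap Z) \<partial>lborel)"
      by (simp add: ul_def mult_ac)
    also have "\<dots> = ?I v al ul"
      by (rule integral_lborel_swap(1)[of "\<lambda>Z. v (fst Z) * al (snd Z) * ul Z"]) measurable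
    finally show "(\<integral>z. (\<integral>s. al (s, snd z) * le s (fst z) \<partial>lborel) * (\<integral>t. v (fst z, t) * le t (snd z) \<partial>lborel) \<partial>lborel) = ?I v al ul" .
  qed
  \<comment> \<open>Three null integrals follow: \<open>u\<close> has total mass 0;
    \<open>be\<close> is integrated along verticals, where [x' \<le> x] is constant;
    \<open>al\<close> is integrated along horizontals, where [y \<le> y'] is constant.\<close>
  have z1: "?I u be (\<lambda>_. 1) = 0"
  proof -
    have "integral\<^sup>L lborel u = 0"
      using u0 by (subst integrable_lborel_Fubini(2)[OF u, symmetric]) (rule integral_eq_zero_AE)
    then show ?thesis
      using integrable_lborel_Fubini(2)[OF int[OF u be, of "\<lambda>_. 1"]] by simp
  qed
  have z2: "?I v be (\<lambda>Z. le (?x' Z) (?x Z)) = 0"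
  proof -
    have "(\<integral>z'. be z' * le (fst z') x \<partial>lborel) = 0" for x
      using integral_mult_const_fibre[OF be be0, of "\<lambda>s. le s x"] by simp
    then have "(\<integral>z'. v z * be z' * le (fst z') (fst z) \<partial>lborel) = 0" for z
      by (simp add: mult.assoc)
    then show ?thesis
      using integrable_lborel_Fubini(1)[OF int[OF v be, of "\<lambda>Z. le (?x' Z) (?x Z)"]] by simp
  qed
  have z3: "?I u al (\<lambda>Z. le (?y Z) (?y' Z)) = 0"
  proof -
    have "(\<integral>z'. al z' * le y (snd z') \<partial>lborel) = 0" for y
    proof -
      have "integrable lborel (\<lambda>z. al (prod.swap z))" by (subst integral_lborel_swap(2)) (use al in auto)
      then have "(\<integral>z. al (prod.swap z) * le y (fst z) \<partial>lborel) = 0"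
        by (rule integral_mult_const_fibre) (use al0 in auto)
      then show ?thesis
        using integral_lborel_swap(1)[of "\<lambda>z'. al z' * le y (snd z')"] by simp
    qed
    then have "(\<integral>z'. u z * al z' * le (snd z) (snd z') \<partial>lborel) = 0" for z
      by (simp add: mult.assoc)
    then show ?thesis
      using integrable_lborel_Fubini(1)[OF int[OF u al, of "\<lambda>Z. le (?y Z) (?y' Z)"]] by simp
  qed
  have "?I u be lr - ?I v al ul = (\<integral>Z. u (fst Z) * be (snd Z) * lr Z - v (fst Z) * al (snd Z) * ul Z \<partial>lborel)"
    using int' u v al be by simp
  \<comment> \<open>Compare coefficients. For \<open>u be\<close>: 1 - (A + B - AB) = (1-A)(1-B).
    For \<open>u al\<close>: B - (1-A)B - AB = 0. For \<open>v be\<close>: A - A(1-B) - AB = 0. For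
    \<open>v al\<close>: only -AB remains.\<close>
  also have "\<dots> = (\<integral>Z. - (u (fst Z) * g (snd Z) * ux Z) - f (fst Z) * be (snd Z) * uy Z - f (fst Z) * g (snd Z) * ul Z
      + u (fst Z) * be (snd Z) * 1 + v (fst Z) * be (snd Z) * le (?x' Z) (?x Z)
      + u (fst Z) * al (snd Z) * le (?y Z) (?y' Z) \<partial>lborel)"
    by (rule Bochner_Integration.integral_cong) (auto simp: f_def g_def ux_def uy_def ul_def lr_def lt_def le_def algebra_simps)
  also have "\<dots> = - ?I u g ux - ?I f be uy - ?I f g ul"
    using int' u v al be f g z1 z2 z3 int[OF u be, of "\<lambda>_. 1"]
      int[OF v be, of "\<lambda>Z. le (?x' Z) (?x Z)"] int[OF u al, of "\<lambda>Z. le (?y Z) (?y' Z)"] by simp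
  finally have I: "?I u be lr - ?I v al ul = - ?I u g ux - ?I f be uy - ?I f g ul" .

  have A: "- ?I u g ux \<le> - ?I f (\<lambda>z. max 0 (- g z)) (\<lambda>Z. le (?x' Z) (?x Z))"
  proof -
    have "AE z' in lborel. \<forall>y. 0 \<le> (\<integral>z. u z * (lt (fst z) (fst z') * le (snd z) y) \<partial>lborel)
     \<and> (\<integral>z. u z * (lt (fst z) (fst z') * le (snd z) y) \<partial>lborel) \<le> - (\<integral>z. f z * le (fst z') (fst z) \<partial>lborel)"
      unfolding f_def
      by (rule AE_lborel_fst_snd(1)[OF mass_below_bounds[OF u v u0 v0 P bm(2)]]) auto
    then have B: "AE z' in lborel. - (g z' * (\<integral>z. u z * (lt (fst z) (fst z') * le (snd z) (snd z')) \<partial>lborel))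
       \<le> - (max 0 (- g z') * (\<integral>z. f z * le (fst z') (fst z) \<partial>lborel))"
    proof eventually_elim
      case (elim z')
      let ?F = "\<integral>z. u z * (lt (fst z) (fst z') * le (snd z) (snd z')) \<partial>lborel"
      have F: "0 \<le> ?F" "?F \<le> - (\<integral>z. f z * le (fst z') (fst z) \<partial>lborel)" using elim by auto
      \<comment> \<open>Nonnegativity of the flux permits the passage from \<open>- g\<close> to the
        negative part of \<open>g\<close>; only then is the coefficient nonnegative, as the upper
        bound on the flux requires.\<close>
      have "- (g z' * ?F) \<le> max 0 (- g z') * ?F"
        using F(1) mult_right_mono[of "- g z'" "max 0 (- g z')" ?F] by simp
      also have "\<dots> \<le> max 0 (- g z') * - (\<integral>z. f z * le (fst z') (fst z) \<partial>lborel)"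
        using F(2) by (intro mult_left_mono) auto
      finally show ?case by simp
    qed
    have i1: "integrable lborel (\<lambda>Z. u (fst Z) * g (snd Z) * ux Z)" by (intro int' u g)
    have i2: "integrable lborel (\<lambda>Z. f (fst Z) * max 0 (- g (snd Z)) * le (?x' Z) (?x Z))"
      by (intro int[OF f gm, simplified]) auto
    have e1: "(\<integral>z. u z * g z' * ux (z, z') \<partial>lborel) = g z' * (\<integral>z. u z * (lt (fst z) (fst z') * le (snd z) (snd z')) \<partial>lborel)" for z'
      by (subst Bochner_Integration.integral_mult_right_zero[symmetric]) (auto simp: ux_def mult_ac)
    have e2: "(\<integral>z. f z * max 0 (- g z') * le (fst z') (fst z) \<partial>lborel) = max 0 (- g z') * (\<integral>z. f z * le (fst z') (fst z) \<partial>lborel)" for z'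
      by (subst Bochner_Integration.integral_mult_right_zero[symmetric]) (auto simp: mult_ac)
    have "- ?I u g ux = (\<integral>z'. - (g z' * (\<integral>z. u z * (lt (fst z) (fst z') * le (snd z) (snd z')) \<partial>lborel)) \<partial>lborel)"
      using integrable_lborel_Fubini(2)[OF i1] e1 by simp
    also have "\<dots> \<le> (\<integral>z'. - (max 0 (- g z') * (\<integral>z. f z * le (fst z') (fst z) \<partial>lborel)) \<partial>lborel)"
      using integrable_lborel_Fubini(6)[OF i1] integrable_lborel_Fubini(6)[OF i2]
      by (intro integral_mono_AE B integrable_minus) (simp_all add: e1 e2)
    also have "\<dots> = - ?I f (\<lambda>z. max 0 (- g z)) (\<lambda>Z. le (?x' Z) (?x Z))"
      using integrable_lborel_Fubini(2)[OF i2] e2 by simp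
    finally show ?thesis .
  qed
  \<comment> \<open>The mirror image of the previous estimate: after exchanging the coordinates,
    \<open>be\<close> and \<open>al\<close> take the places of \<open>u\<close> and
    \<open>v\<close>, and the flux crosses a horizontal ray.\<close>
  have B: "- ?I f be uy \<le> - ?I (\<lambda>z. max 0 (- f z)) g (\<lambda>Z. le (?y Z) (?y' Z))"
  proof -
    have sw: "integrable lborel (\<lambda>z. be (prod.swap z))" "integrable lborel (\<lambda>z. al (prod.swap z))"
      by (subst integral_lborel_swap(2); use be al in auto)+
    have Wsw: "AE z in lborel. 0 \<le> (\<integral>s. be (prod.swap (s, snd z)) * lt s (fst z) \<partial>lborel)"
      using AE_lborel_swap[OF W] by simp
    have e3: "(\<integral>z. be (prod.swap z) * (lt (fst z) y * le (snd z) x) \<partial>lborel) = (\<integral>z. be z * (lt (snd z) y * le (fst z) x) \<partial>lborel)" for x y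
      using integral_lborel_swap(1)[of "\<lambda>z. be z * (lt (snd z) y * le (fst z) x)"] by simp
    have e4: "(\<integral>z. (be (prod.swap z) + al (prod.swap z)) * le y (fst z) \<partial>lborel) = (\<integral>z. g z * le y (snd z) \<partial>lborel)" for y
      using integral_lborel_swap(1)[of "\<lambda>z. (be z + al z) * le y (snd z)"] by (simp add: g_def add.commute)
    have "AE z in lborel. \<forall>x. 0 \<le> (\<integral>z'. be z' * (lt (snd z') (snd z) * le (fst z') x) \<partial>lborel)
     \<and> (\<integral>z'. be z' * (lt (snd z') (snd z) * le (fst z') x) \<partial>lborel) \<le> - (\<integral>z'. g z' * le (snd z) (snd z') \<partial>lborel)"
      by (rule AE_lborel_fst_snd(2)[OF mass_below_bounds[OF sw _ _ Wsw bm(2), unfolded e3 e4]]) (use al0 be0 in auto)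
    then have B: "AE z in lborel. - (f z * (\<integral>z'. be z' * (lt (snd z') (snd z) * le (fst z') (fst z)) \<partial>lborel))
       \<le> - (max 0 (- f z) * (\<integral>z'. g z' * le (snd z) (snd z') \<partial>lborel))"
    proof eventually_elim
      case (elim z)
      let ?F = "\<integral>z'. be z' * (lt (snd z') (snd z) * le (fst z') (fst z)) \<partial>lborel"
      have F: "0 \<le> ?F" "?F \<le> - (\<integral>z'. g z' * le (snd z) (snd z') \<partial>lborel)" using elim by auto
      have "- (f z * ?F) \<le> max 0 (- f z) * ?F"
        using F(1) mult_right_mono[of "- f z" "max 0 (- f z)" ?F] by simp
      also have "\<dots> \<le> max 0 (- f z) * - (\<integral>z'. g z' * le (snd z) (snd z') \<partial>lborel)"
        using F(2) by (intro mult_left_mono) auto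
      finally show ?case by simp
    qed
    have i1: "integrable lborel (\<lambda>Z. f (fst Z) * be (snd Z) * uy Z)" by (intro int' be f)
    have i2: "integrable lborel (\<lambda>Z. max 0 (- f (fst Z)) * g (snd Z) * le (?y Z) (?y' Z))"
      by (intro int[OF fm g, simplified]) auto
    have e1: "(\<integral>z'. f z * be z' * uy (z, z') \<partial>lborel) = f z * (\<integral>z'. be z' * (lt (snd z') (snd z) * le (fst z') (fst z)) \<partial>lborel)" for z
      by (subst Bochner_Integration.integral_mult_right_zero[symmetric]) (auto simp: uy_def mult_ac)
    have e2: "(\<integral>z'. max 0 (- f z) * g z' * le (snd z) (snd z') \<partial>lborel) = max 0 (- f z) * (\<integral>z'. g z' * le (snd z) (snd z') \<partial>lborel)" for z
      by (subst Bochner_Integration.integral_mult_right_zero[symmetric]) (auto simp: mult_ac)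
    have "- ?I f be uy = (\<integral>z. - (f z * (\<integral>z'. be z' * (lt (snd z') (snd z) * le (fst z') (fst z)) \<partial>lborel)) \<partial>lborel)"
      using integrable_lborel_Fubini(1)[OF i1] e1 by simp
    also have "\<dots> \<le> (\<integral>z. - (max 0 (- f z) * (\<integral>z'. g z' * le (snd z) (snd z') \<partial>lborel)) \<partial>lborel)"
      using integrable_lborel_Fubini(5)[OF i1] integrable_lborel_Fubini(5)[OF i2]
      by (intro integral_mono_AE B integrable_minus) (simp_all add: e1 e2)
    also have "\<dots> = - ?I (\<lambda>z. max 0 (- f z)) g (\<lambda>Z. le (?y Z) (?y' Z))"
      using integrable_lborel_Fubini(1)[OF i2] e2 by simp
    finally show ?thesis .
  qed
  have i2: "integrable lborel (\<lambda>Z. f (fst Z) * max 0 (- g (snd Z)) * le (?x' Z) (?x Z))"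
    "integrable lborel (\<lambda>Z. max 0 (- f (fst Z)) * g (snd Z) * le (?y Z) (?y' Z))"
    by (intro int[OF f gm, simplified] int[OF fm g, simplified]; simp)+
  have "- ?I f (\<lambda>z. max 0 (- g z)) (\<lambda>Z. le (?x' Z) (?x Z)) - ?I (\<lambda>z. max 0 (- f z)) g (\<lambda>Z. le (?y Z) (?y' Z)) - ?I f g ul
    = (\<integral>Z. - (f (fst Z) * max 0 (- g (snd Z)) * le (?x' Z) (?x Z)) - (max 0 (- f (fst Z)) * g (snd Z) * le (?y Z) (?y' Z)) 
         - f (fst Z) * g (snd Z) * ul Z \<partial>lborel)"
    using i2 int'(3)[OF f g] by simp
  also have "\<dots> \<le> (\<integral>Z. max 0 (- f (fst Z)) * max 0 (- g (snd Z)) \<partial>lborel)"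
  proof (rule integral_mono)
    show "integrable lborel (\<lambda>Z. - (f (fst Z) * max 0 (- g (snd Z)) * le (?x' Z) (?x Z)) - (max 0 (- f (fst Z)) * g (snd Z) * le (?y Z) (?y' Z)) 
         - f (fst Z) * g (snd Z) * ul Z)"
      using i2 int'(3)[OF f g] by simp
    show "integrable lborel (\<lambda>Z. max 0 (- f (fst Z)) * max 0 (- g (snd Z)))"
      by (rule integrable_lborel_tensor[OF fm gm])
    fix Z
    \<comment> \<open>The critical case is A = B = 1. Writing a and b as differences of positive and
      negative parts, the left side is the product of the negative parts minus the product of the
      positive parts.\<close>
    have key: "- (a * max 0 (- b) * A) - max 0 (- a) * b * B - a * b * (A * B) \<le> max 0 (- a) * max 0 (- b)"
      if "A = 0 \<or> A = 1" "B = 0 \<or> B = 1" for a b A B :: real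
      using that mult_nonneg_nonneg[of a b] mult_nonneg_nonneg[of "-a" "-b"] mult_nonneg_nonneg[of a "-b"] mult_nonneg_nonneg[of "-a" b]
      by (auto simp: max_def)
    show "- (f (fst Z) * max 0 (- g (snd Z)) * le (?x' Z) (?x Z)) - (max 0 (- f (fst Z)) * g (snd Z) * le (?y Z) (?y' Z)) 
         - f (fst Z) * g (snd Z) * ul Z \<le> max 0 (- f (fst Z)) * max 0 (- g (snd Z))"
      unfolding ul_def by (rule key) (auto simp: le_def)
  qed
  also have "\<dots> = (\<integral>z. max 0 (- f z) \<partial>lborel) * (\<integral>z. max 0 (- g z) \<partial>lborel)"
    using integrable_lborel_Fubini(1)[OF integrable_lborel_tensor[OF fm gm]] by simp
  finally have "?I u be lr - ?I v al ul \<le> (\<integral>z. max 0 (- f z) \<partial>lborel) * (\<integral>z. max 0 (- g z) \<partial>lborel)"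
    using I A B by linarith
  then show ?thesis
    using 1 2 by (simp add: f_def g_def)
qed

section \<open>Weak derivatives and primitives\<close>

text \<open>The lower orthants are closed under intersection and generate the Borel sets. Integrals
  over them determine the integral over every Borel set, hence the density.\<close>

lemma AE_zero_if_integral_atMost_zero:
  fixes k :: "'a::ordered_euclidean_space \<Rightarrow> real"
  assumes k: "integrable lborel k" and 0: "\<And>a. (\<integral>x. k x * indicator {..a} x \<partial>lborel) = 0"
  shows "AE x in lborel. k x = 0"
proof -
  have si: "set_integrable lborel A k" if "A \<in> sets borel" for A
    using integrable_mult_indicator[OF _ k, of A] that by (simp add: set_integrable_def)
  have atMost: "(LINT x:{..a}|lborel. k x) = 0" for a
    using 0[of a] by (simp add: set_lebesgue_integral_def mult.commute)
  have univ: "(LINT x:UNIV|lborel. k x) = 0"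
  proof -
    \<comment> \<open>Orthants with corner (n, ..., n) exhaust the space; this supplies the whole
      space, needed for complements.\<close>
    define A where "A n = {..(\<Sum>b\<in>Basis. real n *\<^sub>R b :: 'a)}" for n :: nat
    have "(\<Union>n. A n) = UNIV"
    proof safe
      fix x :: 'a
      obtain n where n: "Max ((\<bullet>) x ` Basis) \<le> real n" using real_arch_simple by blast
      then have "x \<in> A n"
        unfolding A_def by (auto simp: eucl_le[where 'a='a] Max_le_iff)
      then show "x \<in> (\<Union>n. A n)" by blast
    qed simp
    moreover have "incseq A"
      by (auto simp: incseq_def A_def eucl_le[where 'a='a] intro: order_trans)
    ultimately have "(\<lambda>n. LINT x:A n|lborel. k x) \<longlonglongrightarrow> (LINT x:UNIV|lborel. k x)"
      using set_integral_cont_up[of A lborel k] si[of UNIV] by (auto simp: A_def)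
    then show ?thesis
      using LIMSEQ_unique[OF _ tendsto_const] by (fastforce simp: A_def atMost)
  qed
  have "(LINT x:A|lborel. k x) = 0" if "A \<in> sets borel" for A
  proof -
    have "Int_stable (range (\<lambda>a::'a. {..a}))"
    proof -
      have "{..a} \<inter> {..b} = {..inf a b}" for a b :: 'a by auto
      then show ?thesis by (auto simp: Int_stable_def)
    qed
    moreover have "range (\<lambda>a::'a. {..a}) \<subseteq> Pow UNIV" by simp
    moreover have "A \<in> sigma_sets UNIV (range (\<lambda>a::'a. {..a}))"
      using that by (simp add: borel_eq_atMost)
    ultimately show ?thesis
    proof (induction rule: sigma_sets_induct_disjoint)
      case (basic A) then show ?case using atMost by auto
    next
      case empty then show ?case by (simp add: set_lebesgue_integral_def)
    next
      case (compl A)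
      then have A: "A \<in> sets borel" by (simp add: borel_eq_atMost)
      then have "(LINT x:A \<union> (UNIV - A)|lborel. k x) = (LINT x:A|lborel. k x) + (LINT x:(UNIV - A)|lborel. k x)"
        by (intro set_integral_Un si) auto
      then show ?case using compl univ by (simp add: Un_absorb1)
    next
      case (union A)
      then have A: "A i \<in> sets borel" for i by (auto simp: borel_eq_atMost)
      then have "(LINT x:(\<Union>i. A i)|lborel. k x) = (\<Sum>i. (LINT x:(A i)|lborel. k x))"
        using union(1) by (intro lebesgue_integral_countable_add si) (auto simp: disjoint_family_on_def)
      then show ?case using union by simp
    qed
  qed
  then have "AE x in lborel. k x = (\<lambda>_. 0) x"
    by (intro density_unique_real k) auto
  then show ?thesis by simp
qed

section \<open>Smooth functions of one real variable\<close>

primrec C1_k :: "nat \<Rightarrow> (real \<Rightarrow> real) \<Rightarrow> bool" where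
  "C1_k 0 f \<longleftrightarrow> continuous_on UNIV f"
| "C1_k (Suc k) f \<longleftrightarrow> (\<forall>x. f differentiable at x) \<and> C1_k k (deriv f)"

text \<open>One-dimensional counterpart of the regularity in \<open>test_function\<close>, without a
  support condition: compact support is supplied later by multiplication with a cutoff.\<close>

definition smooth :: "(real \<Rightarrow> real) \<Rightarrow> bool" where "smooth f \<longleftrightarrow> (\<forall>k. C1_k k f)"

lemma C1_k_SucI: 
  assumes "\<And>x. (f has_real_derivative f' x) (at x)" "C1_k k f'"
  shows "C1_k (Suc k) f"
proof -
  have "deriv f = f'" using assms(1) by (auto intro: DERIV_imp_deriv)
  with assms show ?thesis by (auto simp: real_differentiable_def)
qed

lemma C1_k_deriv: "C1_k (Suc k) f \<Longrightarrow> (f has_real_derivative deriv f x) (at x)"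
  by (metis C1_k.simps(2) DERIV_imp_deriv real_differentiable_def)

lemma C1_k_mono: "C1_k (Suc k) f \<Longrightarrow> C1_k k f"
proof (induction k arbitrary: f)
  case 0 then show ?case
    by (auto intro!: differentiable_imp_continuous_on simp: differentiable_on_def intro: differentiable_at_withinI)
qed auto

lemma C1_k_const: "C1_k k (\<lambda>_. c)"
proof (induction k arbitrary: c)
  case (Suc k) show ?case by (rule C1_k_SucI[where f' = "\<lambda>_. 0"]) (auto intro: Suc)
qed (auto intro: continuous_intros)

lemma C1_k_add: "C1_k k f \<Longrightarrow> C1_k k g \<Longrightarrow> C1_k k (\<lambda>x. f x + g x)"
proof (induction k arbitrary: f g)
  case (Suc k) show ?case
    by (rule C1_k_SucI[where f' = "\<lambda>x. deriv f x + deriv g x"])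
      (use Suc in \<open>auto intro!: DERIV_add C1_k_deriv[of k]\<close>)
qed (auto intro: continuous_intros)

lemma C1_k_mult: "C1_k k f \<Longrightarrow> C1_k k g \<Longrightarrow> C1_k k (\<lambda>x. f x * g x)"
proof (induction k arbitrary: f g)
  case (Suc k) show ?case
    by (rule C1_k_SucI[OF DERIV_mult[OF C1_k_deriv[OF Suc.prems(1)] C1_k_deriv[OF Suc.prems(2)]]])
      (use Suc C1_k_mono[OF Suc.prems(1)] C1_k_mono[OF Suc.prems(2)] in \<open>auto intro!: C1_k_add\<close>)
qed (auto intro: continuous_intros)

lemma C1_k_affine: "C1_k k f \<Longrightarrow> C1_k k (\<lambda>x. f (a * x + b))"
proof (induction k arbitrary: f)
  case 0 then show ?case by (auto intro!: continuous_intros intro: continuous_on_compose2)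
next
  case (Suc k)
  have "((\<lambda>x. f (a * x + b)) has_real_derivative deriv f (a * x + b) * a) (at x)" for x
    by (rule DERIV_chain2[OF C1_k_deriv[OF Suc.prems]]) (auto intro!: derivative_eq_intros)
  then show ?case
    by (rule C1_k_SucI) (use Suc C1_k_const in \<open>auto intro!: C1_k_mult\<close>)
qed

lemma smooth_const: "smooth (\<lambda>_. c)"
  and smooth_mult: "smooth f \<Longrightarrow> smooth g \<Longrightarrow> smooth (\<lambda>x. f x * g x)"
  and smooth_affine: "smooth f \<Longrightarrow> smooth (\<lambda>x. f (a * x + b))"
  by (auto simp: smooth_def C1_k_const C1_k_mult C1_k_affine)

lemma smooth_deriv:
  assumes "smooth f"
  shows "(f has_real_derivative deriv f x) (at x)" "smooth (deriv f)" 
  using assms C1_k_deriv[of 0 f] by (auto simp: smooth_def simp del: C1_k.simps) (use C1_k.simps(2) in blast)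

lemma smooth_continuous: "smooth f \<Longrightarrow> continuous_on UNIV f"
  by (metis smooth_def C1_k.simps(1))

lemma smooth_measurable: "smooth f \<Longrightarrow> f \<in> borel_measurable borel"
  by (intro borel_measurable_continuous_onI smooth_continuous)

lemma smoothI:
  assumes "\<And>x. (f has_real_derivative f' x) (at x)" "smooth f'"
  shows "smooth f"
  unfolding smooth_def
proof
  fix k
  show "C1_k k f"
    using C1_k_SucI[OF assms(1)] assms(2) C1_k_mono unfolding smooth_def by blast
qed

text \<open>Makes every smooth function a derivative \<open>deriv F\<close> that may be tested
  against a weak derivative. The free constant is fixed so that the boundary term at
  \<open>a\<close> disappears.\<close>

lemma ex_smooth_antiderivative:
  assumes "smooth f"
  obtains F where "smooth F" "\<And>x. (F has_real_derivative f x) (at x)" "F a = 0"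
proof -
  define F where "F u = (LBINT y=0..ereal u. f y)" for u :: real
  have F: "(F has_real_derivative f x) (at x)" for x
  proof -
    have "(F has_vector_derivative f x) (at x within {- \<bar>x\<bar> - 1..\<bar>x\<bar> + 1})"
      unfolding F_def zero_ereal_def
      by (rule interval_integral_FTC2) (use smooth_continuous[OF assms] in \<open>auto intro: continuous_on_subset\<close>)
    moreover have "at x within {- \<bar>x\<bar> - 1..\<bar>x\<bar> + 1} = at x"
      by (rule at_within_Icc_at) auto
    ultimately show ?thesis
      by (simp add: has_real_derivative_iff_has_vector_derivative)
  qed
  have G: "((\<lambda>x. F x - F a) has_real_derivative f x) (at x)" for x
    using DERIV_diff[OF F DERIV_const[of "F a"]] by simp
  show ?thesis
    by (rule that[OF smoothI[OF G assms] G]) simp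
qed

text \<open>A family containing exp(-1/t) and closed under differentiation, so that smoothness at 0
  is an induction over all polynomials at once.\<close>

definition bump_poly :: "real poly \<Rightarrow> real \<Rightarrow> real" where
  "bump_poly Q t = (if t > 0 then poly Q (1 / t) * exp (- 1 / t) else 0)"

lemma poly_div_exp_tendsto_0: "((\<lambda>z::real. poly Q z / exp z) \<longlongrightarrow> 0) at_top"
proof -
  have "((\<lambda>z. \<Sum>i\<le>degree Q. coeff Q i * (z ^ i / exp z)) \<longlongrightarrow> (\<Sum>i\<le>degree Q. coeff Q i * 0)) at_top"
    by (intro tendsto_intros tendsto_power_div_exp_0)
  then show ?thesis
    by (simp add: poly_altdef sum_divide_distrib)
qed

lemma bump_poly_tendsto_0: "(bump_poly Q \<longlongrightarrow> 0) (at 0)"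
proof -
  have "((\<lambda>t. poly Q (inverse t) / exp (inverse t)) \<longlongrightarrow> 0) (at_right 0)"
    by (rule filterlim_compose[OF poly_div_exp_tendsto_0 filterlim_inverse_at_top_right])
  then have "(bump_poly Q \<longlongrightarrow> 0) (at_right 0)"
    by (rule Lim_transform_eventually)
      (auto simp: eventually_at_right_less bump_poly_def exp_minus field_simps eventually_at_topological
        intro!: eventually_at_rightI[of 0 1])
  moreover have "(bump_poly Q \<longlongrightarrow> 0) (at_left 0)"
    by (rule tendsto_eventually) (auto simp: bump_poly_def intro!: eventually_at_leftI[of "-1"])
  ultimately show ?thesis
    by (simp add: filterlim_split_at)
qed

text \<open>For t > 0 the derivative is (Q(1/t) - Q'(1/t)) exp(-1/t) / t^2, and 1/t^2 is the
  polynomial X^2 evaluated at 1/t.\<close>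

lemma bump_poly_has_derivative:
  "(bump_poly Q has_real_derivative bump_poly ([:0, 0, 1:] * (Q - pderiv Q)) x) (at x)"
proof -
  consider "x > 0" | "x < 0" | "x = 0" by linarith
  then show ?thesis
  proof cases
    case 1
    have "((\<lambda>t. poly Q (1 / t) * exp (- 1 / t)) has_real_derivative bump_poly ([:0, 0, 1:] * (Q - pderiv Q)) x) (at x)"
      using 1 by (auto intro!: derivative_eq_intros DERIV_chain2[OF poly_DERIV] simp: bump_poly_def power2_eq_square field_simps)
    then show ?thesis
      by (rule has_field_derivative_transform_within[where d=x, OF _ 1]) (auto simp: bump_poly_def dist_real_def)
  next
    case 2
    have "((\<lambda>t. 0) has_real_derivative 0) (at x)" by simp
    then have "(bump_poly Q has_real_derivative 0) (at x)"
      by (rule has_field_derivative_transform_within[where d="-x"]) (use 2 in \<open>auto simp: bump_poly_def dist_real_def\<close>)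
    then show ?thesis using 2 by (simp add: bump_poly_def)
  next
    case 3
    \<comment> \<open>The difference quotient at 0 is again a member of the family, with Q replaced
      by X Q, and so tends to 0.\<close>
    have "bump_poly ([:0, 1:] * Q) = (\<lambda>t. (bump_poly Q t - bump_poly Q 0) / (t - 0))"
      by (auto simp: bump_poly_def fun_eq_iff)
    then have "((\<lambda>t. (bump_poly Q t - bump_poly Q 0) / (t - 0)) \<longlongrightarrow> 0) (at 0)"
      using bump_poly_tendsto_0[of "[:0, 1:] * Q"] by simp
    then show ?thesis
      using 3 by (simp add: has_field_derivative_iff bump_poly_def)
  qed
qed

definition flat :: "real \<Rightarrow> real" where "flat t = (if t > 0 then exp (- 1 / t) else 0)"

lemma smooth_flat: "smooth flat"
proof -
  have "C1_k k (bump_poly Q)" for k Q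
  proof (induction k arbitrary: Q)
    case 0
    have "isCont (bump_poly Q) x" for x
      by (rule DERIV_isCont[OF bump_poly_has_derivative])
    then show ?case by (simp add: continuous_at_imp_continuous_on)
  next
    case (Suc k)
    show ?case by (rule C1_k_SucI[OF bump_poly_has_derivative Suc])
  qed
  moreover have "bump_poly 1 = flat" by (auto simp: fun_eq_iff bump_poly_def flat_def)
  ultimately show ?thesis unfolding smooth_def by metis
qed

lemma flat_bounds: "0 \<le> flat t" "flat t \<le> 1"
  by (auto simp: flat_def)

text \<open>The witness is \<open>flat\<close> at n^2 (c - x) + n. The shift n drives the argument
  to infinity even at x = c, so the limit is the closed half-line; for x > c the quadratic
  coefficient wins and the argument is eventually nonpositive.\<close>

lemma smooth_approx_atMost:
  obtains h :: "nat \<Rightarrow> real \<Rightarrow> real" where "\<And>n. smooth (h n)" "\<And>n x. 0 \<le> h n x" "\<And>n x. h n x \<le> 1"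
    "\<And>x. (\<lambda>n. h n x) \<longlonglongrightarrow> indicator {..c} x"
proof
  let ?h = "\<lambda>n x. flat ((- (real n)\<^sup>2) * x + ((real n)\<^sup>2 * c + real n))"
  show "smooth (?h n)" for n by (rule smooth_affine[OF smooth_flat])
  show "0 \<le> ?h n x" "?h n x \<le> 1" for n x by (rule flat_bounds)+
  show "(\<lambda>n. ?h n x) \<longlonglongrightarrow> indicator {..c} x" for x
  proof (cases "x \<le> c")
    case True
    have "(\<lambda>n. exp (- 1 / real n)) \<longlonglongrightarrow> exp (0::real)"
      by (intro tendsto_exp lim_const_over_n)
    moreover have "exp (- 1 / real n) \<le> ?h n x" if "n > 0" for n
    proof -
      have *: "exp (- 1 / m) \<le> flat t" if "0 < m" "m \<le> t" for m t
        using that by (simp add: flat_def frac_le)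
      show ?thesis
        by (rule *) (use mult_left_mono[OF True, of "(real n)\<^sup>2"] that in auto)
    qed
    then have "eventually (\<lambda>n. exp (- 1 / real n) \<le> ?h n x) sequentially"
      by (intro eventually_sequentiallyI[of 1]) simp
    ultimately have "(\<lambda>n. ?h n x) \<longlonglongrightarrow> 1"
      using tendsto_sandwich[of "\<lambda>n. exp (- 1 / real n)" "\<lambda>n. ?h n x" sequentially "\<lambda>_. 1" 1]
      by (simp add: flat_bounds)
    then show ?thesis using True by simp
  next
    case False
    obtain N where N: "1 / (x - c) \<le> real N" using real_arch_simple by blast
    have "?h n x = 0" if "n \<ge> max N 1" for n
    proof -
      have "1 / (x - c) \<le> real n" using N that by simp
      then have "1 \<le> real n * (x - c)" using False by (simp add: pos_divide_le_eq)
      then have "real n * 1 \<le> real n * (real n * (x - c))" by (intro mult_left_mono) auto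
      then show ?thesis by (simp add: flat_def power2_eq_square algebra_simps)
    qed
    then have "(\<lambda>n. ?h n x) \<longlonglongrightarrow> 0" by (intro tendsto_eventually eventually_sequentiallyI)
    then show ?thesis using False by simp
  qed
qed

lemma tendsto_integral_bounded_mult:
  fixes k :: "'a::euclidean_space \<Rightarrow> real"
  assumes k: "integrable lborel k" and h: "\<And>n. h n \<in> borel_measurable borel" "\<And>n x. \<bar>h n x\<bar> \<le> 1"
    and lim: "\<And>x. (\<lambda>n. h n x) \<longlonglongrightarrow> g x" and g: "g \<in> borel_measurable borel"
  shows "(\<lambda>n. \<integral>x. k x * h n x \<partial>lborel) \<longlonglongrightarrow> (\<integral>x. k x * g x \<partial>lborel)"
proof (rule integral_dominated_convergence[where w = "\<lambda>x. \<bar>k x\<bar>"])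
  have [measurable]: "k \<in> borel_measurable borel" "\<And>n. h n \<in> borel_measurable borel" "g \<in> borel_measurable borel"
    using k h g by (auto dest: borel_measurable_integrable)
  show "(\<lambda>x. k x * g x) \<in> borel_measurable lborel" "\<And>n. (\<lambda>x. k x * h n x) \<in> borel_measurable lborel"
    by measurable
qed (use k lim h(2) in \<open>auto intro!: tendsto_intros simp: abs_mult mult_left_le\<close>)

text \<open>The indicator of a lower-left quadrant is a product of two half-line indicators, each a
  bounded limit of smooth functions. Dominated convergence then reduces the claim to integrals over
  quadrants.\<close>

lemma AE_zero_if_smooth_tensor_integral_zero:
  fixes k :: "real \<times> real \<Rightarrow> real"
  assumes k: "integrable lborel k"
    and 0: "\<And>\<theta> \<psi>. smooth \<theta> \<Longrightarrow> smooth \<psi> \<Longrightarrow> (\<integral>z. k z * (\<theta> (fst z) * \<psi> (snd z)) \<partial>lborel) = 0"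
  shows "AE z in lborel. k z = 0"
proof (rule AE_zero_if_integral_atMost_zero[OF k])
  fix a :: "real \<times> real"
  obtain h where h: "\<And>n. smooth (h n)" "\<And>n x. 0 \<le> h n x" "\<And>n x. h n x \<le> 1"
    "\<And>x. (\<lambda>n. h n x) \<longlonglongrightarrow> indicator {..fst a} x"
    using smooth_approx_atMost[of "fst a"] by metis
  obtain g where g: "\<And>n. smooth (g n)" "\<And>n x. 0 \<le> g n x" "\<And>n x. g n x \<le> 1"
    "\<And>x. (\<lambda>n. g n x) \<longlonglongrightarrow> indicator {..snd a} x"
    using smooth_approx_atMost[of "snd a"] by metis
  have [measurable]: "h n \<in> borel_measurable borel" "g n \<in> borel_measurable borel" for n
    using h(1) g(1) by (auto intro: smooth_measurable)
  have "(\<lambda>n. \<integral>z. k z * (h n (fst z) * g n (snd z)) \<partial>lborel) \<longlonglongrightarrow>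
      (\<integral>z. k z * (indicator {..fst a} (fst z) * indicator {..snd a} (snd z)) \<partial>lborel)"
    by (rule tendsto_integral_bounded_mult[OF k])
      (use h g in \<open>auto intro!: tendsto_mult mult_le_one simp: abs_mult\<close>)
  moreover have "(indicator {..fst a} (fst z) * indicator {..snd a} (snd z) :: real) = indicator {..a} z" for z
    by (auto simp: indicator_def less_eq_prod_def)
  ultimately show "(\<integral>z. k z * indicator {..a} z \<partial>lborel) = 0"
    using 0 h g by (auto intro: LIMSEQ_unique)
qed

lemma AE_zero_if_smooth_integral_zero:
  fixes k :: "real \<Rightarrow> real"
  assumes k: "integrable lborel k"
    and 0: "\<And>\<psi>. smooth \<psi> \<Longrightarrow> (\<integral>z. k z * \<psi> z \<partial>lborel) = 0"
  shows "AE z in lborel. k z = 0"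
proof (rule AE_zero_if_integral_atMost_zero[OF k])
  fix a :: real
  obtain h where h: "\<And>n. smooth (h n)" "\<And>n x. 0 \<le> h n x" "\<And>n x. h n x \<le> 1"
    "\<And>x. (\<lambda>n. h n x) \<longlonglongrightarrow> indicator {..a} x"
    using smooth_approx_atMost[of a] by metis
  have "(\<lambda>n. \<integral>z. k z * h n z \<partial>lborel) \<longlonglongrightarrow> (\<integral>z. k z * indicator {..a} z \<partial>lborel)"
    by (rule tendsto_integral_bounded_mult[OF k])
      (use h in \<open>auto intro: smooth_measurable\<close>)
  then show "(\<integral>z. k z * indicator {..a} z \<partial>lborel) = 0"
    using 0 h by (auto intro: LIMSEQ_unique)
qed

lemma integrable_mult_compact_support:
  fixes k :: "'a::euclidean_space \<Rightarrow> real"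
  assumes k: "integrable lborel k" and c: "continuous_on UNIV c" and K: "compact K"
    and supp: "\<And>z. z \<notin> K \<Longrightarrow> k z = 0"
  shows "integrable lborel (\<lambda>z. k z * c z)"
proof -
  have "bounded (c ` K)"
    by (intro compact_imp_bounded compact_continuous_image K continuous_on_subset[OF c]) auto
  then obtain M where M: "\<And>z. z \<in> K \<Longrightarrow> \<bar>c z\<bar> \<le> M" by (auto simp: bounded_iff)
  have [measurable]: "c \<in> borel_measurable borel" "k \<in> borel_measurable borel"
    using c k by (auto intro: borel_measurable_continuous_onI dest: borel_measurable_integrable)
  show ?thesis
  proof (rule Bochner_Integration.integrable_bound)
    show "integrable lborel (\<lambda>z. M * k z)" using k by simp
    show "AE z in lborel. norm (k z * c z) \<le> norm (M * k z)"
    proof (rule AE_I2)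
      fix z
      show "norm (k z * c z) \<le> norm (M * k z)"
        using supp[of z] M[of z] by (cases "z \<in> K") (auto simp: abs_mult mult.commute intro!: mult_right_mono)
    qed
  qed measurable
qed

text \<open>As \<open>p\<close> and \<open>u\<close> live in a bounded square, the test functions
  may be arbitrary smooth ones. Constants give the vanishing line integrals. An antiderivative
  \<open>F\<close> of \<theta> with \<open>F R = 0\<close> gives the same pairing for
  \<open>p\<close> as Fubini gives for the primitive of \<open>u\<close>, so the two agree.\<close>

lemma weak_derivative_primitive:
  fixes p u :: "real \<times> real \<Rightarrow> real"
  assumes p: "integrable lborel p" and u: "integrable lborel u"
    and supp: "\<And>z. \<not> (\<bar>fst z\<bar> < R \<and> \<bar>snd z\<bar> < R) \<Longrightarrow> p z = 0 \<and> u z = 0"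
    and weak: "\<And>\<phi> \<psi>. smooth \<phi> \<Longrightarrow> smooth \<psi> \<Longrightarrow>
      (\<integral>z. p z * (deriv \<phi> (fst z) * \<psi> (snd z)) \<partial>lborel) = - (\<integral>z. u z * (\<phi> (fst z) * \<psi> (snd z)) \<partial>lborel)"
  shows "AE y in lborel. (\<integral>s. u (s, y) \<partial>lborel) = 0"
    and "AE z in lborel. p z = (\<integral>s. u (s, snd z) * lt s (fst z) \<partial>lborel)"
proof -
  have cont: "continuous_on UNIV (\<lambda>z::real \<times> real. \<theta> (fst z) * \<psi> (snd z))" if "smooth \<theta>" "smooth \<psi>" for \<theta> \<psi>
    by (intro continuous_intros continuous_on_compose2[OF smooth_continuous[OF that(1)]]
        continuous_on_compose2[OF smooth_continuous[OF that(2)]]) auto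
  have cpt: "compact (cbox (-R, -R) (R, R))" by simp
  have supp': "z \<notin> cbox (-R, -R) (R, R) \<Longrightarrow> p z = 0 \<and> u z = 0" for z
    by (rule supp, cases z) (auto simp: cbox_Pair_eq abs_less_iff)
  have ic: "integrable lborel (\<lambda>z. u z * (\<theta> (fst z) * \<psi> (snd z)))" "integrable lborel (\<lambda>z. p z * (\<theta> (fst z) * \<psi> (snd z)))"
    if "smooth \<theta>" "smooth \<psi>" for \<theta> \<psi>
    by (rule integrable_mult_compact_support[OF _ cont[OF that] cpt]; use supp' u p in auto)+
  show u0: "AE y in lborel. (\<integral>s. u (s, y) \<partial>lborel) = 0"
  proof (rule AE_zero_if_smooth_integral_zero)
    show "integrable lborel (\<lambda>y. \<integral>s. u (s, y) \<partial>lborel)"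
      using integrable_lborel_Fubini(6)[OF u] .
    fix \<psi> assume \<psi>: "smooth \<psi>"
    \<comment> \<open>The test function 1 has derivative 0, so the side with \<open>p\<close> drops
      out.\<close>
    have "(\<integral>z. u z * (1 * \<psi> (snd z)) \<partial>lborel) = 0"
      using weak[OF smooth_const[of 1] \<psi>] by simp
    moreover have "(\<integral>z. u z * (1 * \<psi> (snd z)) \<partial>lborel) = (\<integral>y. (\<integral>s. u (s, y) \<partial>lborel) * \<psi> y \<partial>lborel)"
      using integrable_lborel_Fubini(2)[OF ic(1)[OF smooth_const[of 1] \<psi>]] by simp
    ultimately show "(\<integral>y. (\<integral>s. u (s, y) \<partial>lborel) * \<psi> y \<partial>lborel) = 0" by simp
  qed
  define P where "P z = (\<integral>s. u (s, snd z) * lt s (fst z) \<partial>lborel)" for z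
  have ltm: "(\<lambda>z. lt (fst z) (snd z)) \<in> borel_measurable borel" by measurable
  \<comment> \<open>Fubini integrates \<theta> from s to R for each unit of mass of \<open>u\<close>
    at s; the result is F R - F s = - F s. The indicator keeps the pairing integrable although
    \<theta> is unbounded in general.\<close>
  have Ptest: "integrable lborel (\<lambda>z. P z * indicator {-R..R} (fst z) * (\<theta> (fst z) * \<psi> (snd z)))"
    "(\<integral>z. P z * indicator {-R..R} (fst z) * (\<theta> (fst z) * \<psi> (snd z)) \<partial>lborel) =
      - (\<integral>z. u z * (F (fst z) * \<psi> (snd z)) \<partial>lborel)"
    if \<theta>: "smooth \<theta>" and \<psi>: "smooth \<psi>" and F: "\<And>x. (F has_real_derivative \<theta> x) (at x)" "F R = 0" for \<theta> \<psi> F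
  proof -
    define A where "A = (\<lambda>z. u z * (1 * \<psi> (snd z)))"
    \<comment> \<open>The factor \<open>indicator {0..1}\<close> has integral 1; it only puts the Fubini step into the shape of \<open>integral_primitives_mult\<close>.\<close>
    define B where "B = (\<lambda>z::real \<times> real. \<theta> (fst z) * indicator {-R..R} (fst z) * indicator {0..1} (snd z) :: real)"
    have A: "integrable lborel A"
      unfolding A_def by (rule ic(1)[OF smooth_const \<psi>])
    have i\<theta>: "integrable lborel (\<lambda>x. \<theta> x * indicator {-R..R} x)"
      using borel_integrable_compact[of "{-R..R}" \<theta>] smooth_continuous[OF \<theta>] 
      by (auto simp: mult.commute intro: continuous_on_subset)
    have B: "integrable lborel B"
      unfolding B_def by (rule integrable_lborel_tensor[OF i\<theta>]) simp
    have a: "(\<integral>s. A (s, snd z) * lt s (fst z) \<partial>lborel) = P z * \<psi> (snd z)" for z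
    proof -
      have "(\<integral>s. A (s, snd z) * lt s (fst z) \<partial>lborel) = (\<integral>s. u (s, snd z) * lt s (fst z) * \<psi> (snd z) \<partial>lborel)"
        by (rule Bochner_Integration.integral_cong) (simp_all add: A_def mult_ac)
      then show ?thesis by (simp add: P_def)
    qed
    have b: "(\<integral>t. B (fst z, t) * 1 \<partial>lborel) = \<theta> (fst z) * indicator {-R..R} (fst z)" for z
      by (simp add: B_def)
    note K = integral_primitives_mult[OF A B ltm, of "\<lambda>_ _. 1", unfolded a b]
    have e: "P z * \<psi> (snd z) * (\<theta> (fst z) * indicator {-R..R} (fst z)) = P z * indicator {-R..R} (fst z) * (\<theta> (fst z) * \<psi> (snd z))" for z
      by (simp add: mult_ac)
    show "integrable lborel (\<lambda>z. P z * indicator {-R..R} (fst z) * (\<theta> (fst z) * \<psi> (snd z)))"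
      using K(1) by (simp add: e)
    have "(\<integral>z. P z * indicator {-R..R} (fst z) * (\<theta> (fst z) * \<psi> (snd z)) \<partial>lborel) =
       (\<integral>Z. A (fst Z) * B (snd Z) * lt (fst (fst Z)) (fst (snd Z)) \<partial>lborel)"
      using K(2) by (simp add: e)
    also have "\<dots> = (\<integral>z. \<integral>z'. A z * B z' * lt (fst z) (fst z') \<partial>lborel \<partial>lborel)"
      by (subst integrable_lborel_Fubini(1)[symmetric])
        (auto intro!: integrable_mult_bounded1 integrable_lborel_tensor A B)
    also have "\<dots> = (\<integral>z. - (u z * (F (fst z) * \<psi> (snd z))) \<partial>lborel)"
    proof (rule Bochner_Integration.integral_cong)
      fix z
      show "(\<integral>z'. A z * B z' * lt (fst z) (fst z') \<partial>lborel) = - (u z * (F (fst z) * \<psi> (snd z)))"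
      \<comment> \<open>Where \<open>u\<close> vanishes both sides are 0. Elsewhere
        \<open>fst z\<close> lies between -R and R, so the indicator and \<open>lt\<close> together
        cut out the interval from \<open>fst z\<close> to R, up to one point.\<close>
      proof (cases "u z = 0")
        case False
        then have z: "- R < fst z" "fst z < R" using supp[of z] by linarith+
        have iB: "integrable lborel (\<lambda>z'. B z' * lt (fst z) (fst z'))"
          by (rule integrable_mult_bounded1[OF B]) auto
        have "(\<integral>z'. B z' * lt (fst z) (fst z') \<partial>lborel) = (\<integral>x. \<theta> x * indicator {-R..R} x * lt (fst z) x \<partial>lborel)"
          by (subst integrable_lborel_Fubini(1)[OF iB, symmetric]) (simp add: B_def mult_ac)
        also have "\<dots> = (\<integral>x. indicator {fst z..R} x *\<^sub>R \<theta> x \<partial>lborel)"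
        proof (rule integral_cong_AE)
          show "AE x in lborel. \<theta> x * indicator {-R..R} x * lt (fst z) x = indicator {fst z..R} x *\<^sub>R \<theta> x"
            using AE_lborel_singleton[of "fst z"] by eventually_elim (use z in \<open>auto simp: lt_def indicator_def\<close>)
        qed (use smooth_measurable[OF \<theta>] in measurable)
        also have "\<dots> = F R - F (fst z)"
          by (rule integral_FTC_atLeastAtMost)
            (use z F(1) smooth_continuous[OF \<theta>] in \<open>auto simp: has_real_derivative_iff_has_vector_derivative[symmetric]
              intro: has_field_derivative_at_within continuous_on_subset\<close>)
        finally show ?thesis by (simp add: A_def F(2) mult.assoc)
      qed (simp add: A_def)
    qed simp
    finally show "(\<integral>z. P z * indicator {-R..R} (fst z) * (\<theta> (fst z) * \<psi> (snd z)) \<partial>lborel) =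
      - (\<integral>z. u z * (F (fst z) * \<psi> (snd z)) \<partial>lborel)" by simp
  qed
  have "AE z in lborel. p z - P z * indicator {-R..R} (fst z) = 0"
  proof (rule AE_zero_if_smooth_tensor_integral_zero)
    \<comment> \<open>With both test functions equal to 1, \<open>Ptest\<close> yields the
      integrability of the truncated primitive.\<close>
    obtain F where F: "smooth F" "\<And>x. (F has_real_derivative 1) (at x)" "F R = 0"
      using ex_smooth_antiderivative[OF smooth_const[of 1]] by metis
    have "integrable lborel (\<lambda>z. P z * indicator {-R..R} (fst z))"
      using Ptest(1)[OF smooth_const[of 1] smooth_const[of 1] F(2,3)] by simp
    then show "integrable lborel (\<lambda>z. p z - P z * indicator {-R..R} (fst z))"
      using p by simp
    fix \<theta> \<psi> assume \<theta>: "smooth \<theta>" and \<psi>: "smooth \<psi>"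
    obtain F where F: "smooth F" "\<And>x. (F has_real_derivative \<theta> x) (at x)" "F R = 0"
      using ex_smooth_antiderivative[OF \<theta>] by metis
    have "deriv F = \<theta>" using F(2) by (auto intro: DERIV_imp_deriv)
    then show "(\<integral>z. (p z - P z * indicator {-R..R} (fst z)) * (\<theta> (fst z) * \<psi> (snd z)) \<partial>lborel) = 0"
      using weak[OF F(1) \<psi>] ic(2)[OF \<theta> \<psi>] Ptest[OF \<theta> \<psi> F(2,3)] by (simp add: left_diff_distrib)
  qed
  then have "AE z in lborel. p z = P z"
    using AE_lborel_fst_snd(2)[OF u0]
  proof eventually_elim
    case (elim z)
    have us: "u (s, y) = 0" if "\<not> \<bar>s\<bar> < R" for s y
      using supp[of "(s, y)"] that by simp
    \<comment> \<open>Outside the strip \<open>p\<close> is 0. So is the primitive: on the left no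
      mass has been collected, on the right the integral runs over the whole line.\<close>
    consider "fst z < - R" | "fst z \<in> {-R..R}" | "fst z > R" by force
    then show ?case
    proof cases
      case 1
      then have "u (s, snd z) * lt s (fst z) = 0" for s
        using us[of s "snd z"] 1 by (cases "\<bar>s\<bar> < R") (auto simp: lt_def)
      then have "P z = 0" unfolding P_def by (simp only: Bochner_Integration.integral_zero)
      then show ?thesis using 1 elim by simp
    next
      case 3
      then have "u (s, snd z) * lt s (fst z) = u (s, snd z)" for s
        using us[of s "snd z"] 3 by (cases "\<bar>s\<bar> < R") (auto simp: lt_def)
      then have "P z = 0" unfolding P_def by (simp only: elim(2))
      then show ?thesis using 3 elim by simp
    qed (use elim in simp)
  qed
  then show "AE z in lborel. p z = (\<integral>s. u (s, snd z) * lt s (fst z) \<partial>lborel)"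
    by (simp add: P_def)
qed

section \<open>Cutoff functions\<close>

text \<open>On (-1, 1) this is exp(2 - 1/(1-t) - 1/(1+t)), that is exp(2 - 2/(1-t^2)). The factor
  exp 2 normalises the maximum, attained at 0, to 1. The affine arguments are spelled out to match
  \<open>smooth_affine\<close>.\<close>

definition bump :: "real \<Rightarrow> real" where
  "bump t = exp 2 * (flat (- 1 * t + 1) * flat (1 * t + 1))"

lemma smooth_bump: "smooth bump"
  unfolding bump_def by (intro smooth_mult smooth_const smooth_affine smooth_flat)

lemma bump_nonneg: "0 \<le> bump t"
  by (simp add: bump_def flat_bounds)

lemma bump_eq_0: "\<bar>t\<bar> \<ge> 1 \<Longrightarrow> bump t = 0"
  by (auto simp: bump_def flat_def)

lemma bump_0: "bump 0 = 1"
  by (simp add: bump_def flat_def exp_add[symmetric])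

lemma bump_le_1: "bump t \<le> 1"
proof (cases "\<bar>t\<bar> < 1")
  case True
  then have t: "0 < 1 - t" "0 < 1 + t" by auto
  have "1 / (1 - t) + 1 / (1 + t) = 2 / ((1 - t) * (1 + t))"
    using t by (simp add: field_simps)
  moreover have "2 / 1 \<le> 2 / ((1 - t) * (1 + t))"
    using mult_pos_pos[OF t] zero_le_square[of t] by (intro divide_left_mono) (auto simp: algebra_simps)
  ultimately have "2 + (- 1 / (1 - t) + - 1 / (1 + t)) \<le> 0" by simp
  moreover have "bump t = exp (2 + (- 1 / (1 - t) + - 1 / (1 + t)))"
    using t unfolding exp_add by (simp add: bump_def flat_def add.commute)
  ultimately show ?thesis by simp
qed (simp add: bump_eq_0)

lemma deriv_bump_0: "deriv bump 0 = 0"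
  by (rule DERIV_local_max[OF smooth_deriv(1)[OF smooth_bump], of 1]) (auto simp: bump_0 bump_le_1)

text \<open>Each such point, the endpoints 1 and -1 included, is a minimum of the nonnegative
  function \<open>bump\<close>.\<close>

lemma deriv_bump_eq_0: "\<bar>t\<bar> \<ge> 1 \<Longrightarrow> deriv bump t = 0"
  by (rule DERIV_local_min[OF smooth_deriv(1)[OF smooth_bump], of 1]) (auto simp: bump_eq_0 bump_nonneg)

lemma deriv_bump_bounded: obtains M where "\<And>t. \<bar>deriv bump t\<bar> \<le> M"
proof -
  have "compact (deriv bump ` {-1..1})"
    using smooth_continuous[OF smooth_deriv(2)[OF smooth_bump]]
    by (intro compact_continuous_image) (auto intro: continuous_on_subset)
  then obtain M where M: "\<And>t. t \<in> {-1..1} \<Longrightarrow> \<bar>deriv bump t\<bar> \<le> M"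
    using compact_imp_bounded by (fastforce simp: bounded_iff)
  show ?thesis
  proof (rule that)
    fix t
    have "0 \<le> M" using M[of 0] by simp
    then show "\<bar>deriv bump t\<bar> \<le> M"
      using M[of t] deriv_bump_eq_0[of t] by (cases "\<bar>t\<bar> \<ge> 1") (auto simp: not_le abs_less_iff)
  qed
qed

definition cutoff :: "real \<Rightarrow> real \<Rightarrow> real" where
  "cutoff R t = bump (1 / R * t + 0)"

lemma smooth_cutoff: "smooth (cutoff R)"
  unfolding cutoff_def by (intro smooth_affine smooth_bump)

lemma cutoff_nonneg: "0 \<le> cutoff R t" and cutoff_le_1: "cutoff R t \<le> 1"
  by (simp_all add: cutoff_def bump_nonneg bump_le_1)

lemma deriv_cutoff: "deriv (cutoff R) t = deriv bump (t / R) / R"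
proof -
  have "((\<lambda>t. bump (1 / R * t + 0)) has_real_derivative deriv bump (1 / R * t + 0) * (1 / R)) (at t)"
    by (rule DERIV_chain2[OF smooth_deriv(1)[OF smooth_bump]],
        rule DERIV_cong[OF DERIV_add[OF DERIV_cmult[OF DERIV_ident] DERIV_const]]) simp
  then show ?thesis
    by (auto simp: cutoff_def[abs_def] intro!: DERIV_imp_deriv)
qed

lemma cutoff_eq_0: "0 < R \<Longrightarrow> \<bar>t\<bar> \<ge> R \<Longrightarrow> cutoff R t = 0"
  and deriv_cutoff_eq_0: "0 < R \<Longrightarrow> \<bar>t\<bar> \<ge> R \<Longrightarrow> deriv (cutoff R) t = 0"
  by (auto simp: cutoff_def deriv_cutoff intro!: bump_eq_0 deriv_bump_eq_0)

definition chi :: "real \<Rightarrow> real \<times> real \<Rightarrow> real" where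
  "chi R z = cutoff R (fst z) * cutoff R (snd z)"

definition dchi :: "real \<Rightarrow> real \<times> real \<Rightarrow> real" where
  "dchi R z = deriv (cutoff R) (fst z) * cutoff R (snd z)"

lemma continuous_on_smooth_tensor:
  assumes "smooth \<theta>" "smooth \<psi>"
  shows "continuous_on UNIV (\<lambda>z::real \<times> real. \<theta> (fst z) * \<psi> (snd z))"
  by (intro continuous_intros continuous_on_compose2[OF smooth_continuous[OF assms(1)]]
        continuous_on_compose2[OF smooth_continuous[OF assms(2)]]) auto

lemma continuous_chi: "continuous_on UNIV (chi R)" and continuous_dchi: "continuous_on UNIV (dchi R)"
  unfolding chi_def[abs_def] dchi_def[abs_def]
  by (intro continuous_on_smooth_tensor smooth_cutoff smooth_deriv(2))+

lemma chi_bounds: "0 \<le> chi R z" "chi R z \<le> 1"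
  by (auto simp: chi_def cutoff_nonneg cutoff_le_1 intro!: mult_le_one)

abbreviation square :: "real \<Rightarrow> (real \<times> real) set" where
  "square R \<equiv> cbox (- R, - R) (R, R)"

lemma chi_eq_0: "0 < R \<Longrightarrow> \<not> (\<bar>fst z\<bar> < R \<and> \<bar>snd z\<bar> < R) \<Longrightarrow> chi R z = 0"
  and dchi_eq_0: "0 < R \<Longrightarrow> \<not> (\<bar>fst z\<bar> < R \<and> \<bar>snd z\<bar> < R) \<Longrightarrow> dchi R z = 0"
  by (auto simp: chi_def dchi_def not_less cutoff_eq_0 deriv_cutoff_eq_0)

lemma not_in_square: "z \<notin> square R \<Longrightarrow> \<not> (\<bar>fst z\<bar> < R \<and> \<bar>snd z\<bar> < R)"
  by (cases z) (auto simp: cbox_Pair_eq abs_less_iff)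

section \<open>Truncated fields\<close>

definition loc_integrable :: "(real \<times> real \<Rightarrow> real) \<Rightarrow> bool" where
  "loc_integrable f \<longleftrightarrow> (\<forall>R. integrable lborel (\<lambda>z. indicator (square R) z * f z))"

lemma loc_integrable_mult:
  assumes "loc_integrable f" "continuous_on UNIV c" "0 < R"
    "\<And>z. \<not> (\<bar>fst z\<bar> < R \<and> \<bar>snd z\<bar> < R) \<Longrightarrow> c z = 0"
  shows "integrable lborel (\<lambda>z. f z * c z)"
proof -
  have "integrable lborel (\<lambda>z. (indicator (square R) z * f z) * c z)"
    by (rule integrable_mult_compact_support[of _ _ "square R"]) (use assms in \<open>auto simp: loc_integrable_def\<close>)
  moreover have "(\<lambda>z. (indicator (square R) z * f z) * c z) = (\<lambda>z. f z * c z)"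
  proof
    fix z
    show "(indicator (square R) z * f z) * c z = f z * c z"
      using assms(4)[OF not_in_square, of z] by (cases "z \<in> square R") simp_all
  qed
  ultimately show ?thesis by simp
qed

text \<open>Weak derivative in the first variable, tested on products of compactly supported
  functions of one variable only. The second variable is treated by composing both functions with
  \<open>prod.swap\<close>.\<close>

definition weak_dx :: "(real \<times> real \<Rightarrow> real) \<Rightarrow> (real \<times> real \<Rightarrow> real) \<Rightarrow> bool" where
  "weak_dx p u \<longleftrightarrow> (\<forall>A B. smooth A \<longrightarrow> smooth B \<longrightarrow> (\<exists>R. \<forall>t. \<bar>t\<bar> \<ge> R \<longrightarrow> A t = 0 \<and> B t = 0) \<longrightarrow>
    (\<integral>z. p z * (deriv A (fst z) * B (snd z)) \<partial>lborel) = - (\<integral>z. u z * (A (fst z) * B (snd z)) \<partial>lborel))"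

text \<open>\<open>U\<close> is the derivative of the truncated function by the product rule. Since
  \<open>chi\<close> is itself a product, multiplying an arbitrary smooth product by it gives a
  product of compactly supported functions, to which \<open>weak_dx\<close> applies.\<close>

lemma cutoff_primitive:
  assumes p: "loc_integrable p" and u: "loc_integrable u"
    and weak: "weak_dx p u" and R: "0 < R"
  defines "U \<equiv> \<lambda>z. u z * chi R z + p z * dchi R z"
  shows "integrable lborel (\<lambda>z. p z * chi R z)" "integrable lborel U"
    and "AE y in lborel. (\<integral>s. U (s, y) \<partial>lborel) = 0"
    and "AE z in lborel. p z * chi R z = (\<integral>s. U (s, snd z) * lt s (fst z) \<partial>lborel)"
proof -
  have i: "integrable lborel (\<lambda>z. p z * chi R z)" "integrable lborel (\<lambda>z. u z * chi R z)"
    "integrable lborel (\<lambda>z. p z * dchi R z)"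
    using p u continuous_chi continuous_dchi R chi_eq_0 dchi_eq_0
    by (blast intro: loc_integrable_mult)+
  show iP: "integrable lborel (\<lambda>z. p z * chi R z)" by fact
  show iU: "integrable lborel U" unfolding U_def using i by simp
  have supp: "p z * chi R z = 0 \<and> U z = 0" if "\<not> (\<bar>fst z\<bar> < R \<and> \<bar>snd z\<bar> < R)" for z
    using chi_eq_0[OF R that] dchi_eq_0[OF R that] by (simp add: U_def)
  have w: "(\<integral>z. (p z * chi R z) * (deriv \<phi> (fst z) * \<psi> (snd z)) \<partial>lborel) = - (\<integral>z. U z * (\<phi> (fst z) * \<psi> (snd z)) \<partial>lborel)"
    if \<phi>: "smooth \<phi>" and \<psi>: "smooth \<psi>" for \<phi> \<psi>
  proof -
    have j: "integrable lborel (\<lambda>z. (f z * c z) * (\<theta> (fst z) * \<psi> (snd z)))"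
      if "integrable lborel (\<lambda>z. f z * c z)" "\<And>z. \<not> (\<bar>fst z\<bar> < R \<and> \<bar>snd z\<bar> < R) \<Longrightarrow> c z = 0" "smooth \<theta>" for f c \<theta>
      by (rule integrable_mult_compact_support[OF that(1) continuous_on_smooth_tensor[OF that(3) \<psi>], of "square R"])
        (use that(2) not_in_square in auto)
    have k: "integrable lborel (\<lambda>z. p z * chi R z * (deriv \<phi> (fst z) * \<psi> (snd z)))"
      "integrable lborel (\<lambda>z. u z * chi R z * (\<phi> (fst z) * \<psi> (snd z)))"
      "integrable lborel (\<lambda>z. p z * dchi R z * (\<phi> (fst z) * \<psi> (snd z)))"
      by (rule j, rule i(1), erule chi_eq_0[OF R], rule smooth_deriv(2)[OF \<phi>])
        (rule j, rule i(2), erule chi_eq_0[OF R], rule \<phi>, rule j, rule i(3), erule dchi_eq_0[OF R], rule \<phi>)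
    have d: "deriv (\<lambda>t. cutoff R t * \<phi> t) t = deriv (cutoff R) t * \<phi> t + cutoff R t * deriv \<phi> t" for t
      by (rule DERIV_imp_deriv) (use DERIV_mult[OF smooth_deriv(1)[OF smooth_cutoff] smooth_deriv(1)[OF \<phi>]] in \<open>simp add: mult.commute add.commute\<close>)
    have a: "U z * (\<phi> (fst z) * \<psi> (snd z)) =
        u z * chi R z * (\<phi> (fst z) * \<psi> (snd z)) + p z * dchi R z * (\<phi> (fst z) * \<psi> (snd z))" for z
      by (simp add: U_def distrib_right)
    have b: "p z * (deriv (\<lambda>t. cutoff R t * \<phi> t) (fst z) * (cutoff R (snd z) * \<psi> (snd z))) =
        p z * dchi R z * (\<phi> (fst z) * \<psi> (snd z)) + p z * chi R z * (deriv \<phi> (fst z) * \<psi> (snd z))" for z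
      unfolding d by (simp add: chi_def dchi_def distrib_left distrib_right mult_ac)
    have c: "u z * ((cutoff R (fst z) * \<phi> (fst z)) * (cutoff R (snd z) * \<psi> (snd z))) =
        u z * chi R z * (\<phi> (fst z) * \<psi> (snd z))" for z
      by (simp add: chi_def mult_ac)
    have "(\<integral>z. p z * (deriv (\<lambda>t. cutoff R t * \<phi> t) (fst z) * (cutoff R (snd z) * \<psi> (snd z))) \<partial>lborel)
      = - (\<integral>z. u z * ((cutoff R (fst z) * \<phi> (fst z)) * (cutoff R (snd z) * \<psi> (snd z))) \<partial>lborel)"
    proof (rule weak[unfolded weak_dx_def, rule_format, OF smooth_mult[OF smooth_cutoff \<phi>] smooth_mult[OF smooth_cutoff \<psi>]])
      show "\<exists>r. \<forall>t. r \<le> \<bar>t\<bar> \<longrightarrow> cutoff R t * \<phi> t = 0 \<and> cutoff R t * \<psi> t = 0"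
        using cutoff_eq_0[OF R] by (intro exI[of _ R]) simp
    qed
    then have e: "(\<integral>z. p z * dchi R z * (\<phi> (fst z) * \<psi> (snd z)) \<partial>lborel) + (\<integral>z. p z * chi R z * (deriv \<phi> (fst z) * \<psi> (snd z)) \<partial>lborel)
      = - (\<integral>z. u z * chi R z * (\<phi> (fst z) * \<psi> (snd z)) \<partial>lborel)"
      unfolding b c Bochner_Integration.integral_add[OF k(3,1)] .
    have f: "m = - (l + n)" if "n + m = - l" for l m n :: real using that by linarith
    show ?thesis
      unfolding a Bochner_Integration.integral_add[OF k(2,3)] by (rule f[OF e])
  qed
  show "AE y in lborel. (\<integral>s. U (s, y) \<partial>lborel) = 0"
    by (rule weak_derivative_primitive(1)[where R = R, OF iP iU]) (erule supp, rule w)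
  show "AE z in lborel. p z * chi R z = (\<integral>s. U (s, snd z) * lt s (fst z) \<partial>lborel)"
    by (rule weak_derivative_primitive(2)[where R = R, OF iP iU]) (erule supp, rule w)
qed

lemma loc_integrable_measurable:
  assumes "loc_integrable f" shows "f \<in> borel_measurable borel"
proof (rule borel_measurable_LIMSEQ_metric)
  show "(\<lambda>z. indicator (square (real n)) z * f z) \<in> borel_measurable borel" for n
    using borel_measurable_integrable[OF assms[unfolded loc_integrable_def, rule_format, of "real n"]] by simp
  show "(\<lambda>n. indicator (square (real n)) z * f z) \<longlonglongrightarrow> f z" for z
  proof -
    obtain N where N: "max \<bar>fst z\<bar> \<bar>snd z\<bar> \<le> real N" using real_arch_simple by blast
    then have "z \<in> square (real n)" if "n \<ge> N" for n
      using of_nat_mono[OF that, where 'a = real] by (cases z) (auto simp: cbox_Pair_eq)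
    then show ?thesis by (intro tendsto_eventually eventually_sequentiallyI[of N]) auto
  qed
qed

lemma loc_integrable_swap:
  assumes "loc_integrable f" shows "loc_integrable (\<lambda>z. f (prod.swap z))"
  unfolding loc_integrable_def
proof
  fix R
  have i: "integrable lborel (\<lambda>z. indicator (square R) z * f z)"
    using assms by (auto simp: loc_integrable_def)
  have "integrable lborel (\<lambda>z. indicator (square R) (prod.swap z) * f (prod.swap z))"
    using integral_lborel_swap(2)[of "\<lambda>z. indicator (square R) z * f z"] i borel_measurable_integrable[OF i] by simp
  moreover have "indicator (square R) (prod.swap z) = (indicator (square R) z :: real)" for z
    by (cases z) (auto simp: indicator_def cbox_Pair_eq)
  ultimately show "integrable lborel (\<lambda>z. indicator (square R) z * f (prod.swap z))" by simp
qed

text \<open>The negative part is (|f| - f) / 2. Used once for each divergence, this produces the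
  constant 1/4.\<close>

lemma integral_neg_part:
  assumes "integrable M f" "integral\<^sup>L M f = (0::real)"
  shows "(\<integral>z. max 0 (- f z) \<partial>M) = (\<integral>z. \<bar>f z\<bar> \<partial>M) / 2"
proof -
  have "(\<integral>z. max 0 (- f z) \<partial>M) = (\<integral>z. (\<bar>f z\<bar> - f z) / 2 \<partial>M)"
    by (rule Bochner_Integration.integral_cong) auto
  also have "\<dots> = (\<integral>z. \<bar>f z\<bar> \<partial>M) / 2"
    using assms by simp
  finally show ?thesis .
qed

text \<open>
  The divergence of the truncated field \<open>chi R (p, q)\<close>, where \<open>f\<close> is the divergence of
  \<open>(p, q)\<close>. By symmetry of \<open>chi\<close>, the partial derivative in the second variable is
  \<open>dchi\<close> with the coordinates swapped.
\<close>

definition cutoff_div :: "real \<Rightarrow> (real \<times> real \<Rightarrow> real) \<Rightarrow> (real \<times> real \<Rightarrow> real) \<Rightarrow> (real \<times> real \<Rightarrow> real) \<Rightarrow> real \<times> real \<Rightarrow> real" where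
  "cutoff_div R f p q z = f z * chi R z + p z * dchi R z + q z * dchi R (prod.swap z)"

text \<open>Applies the core estimate to the first field truncated at \<open>R\<close> and the
  second at \<open>R'\<close>. The determinant is bilinear, so the truncations only multiply it by
  both cutoffs; the radii stay independent.\<close>

lemma integral_det_cutoff_le:
  assumes loc: "loc_integrable p" "loc_integrable q" "loc_integrable r" "loc_integrable w"
      "loc_integrable u" "loc_integrable v" "loc_integrable al" "loc_integrable be"
    and weak: "weak_dx p u" "weak_dx r al"
      "weak_dx (\<lambda>z. q (prod.swap z)) (\<lambda>z. v (prod.swap z))" "weak_dx (\<lambda>z. w (prod.swap z)) (\<lambda>z. be (prod.swap z))"
    and pos: "AE z in lborel. 0 \<le> p z" "AE z in lborel. 0 \<le> w z"
    and R: "0 < R" "0 < R'"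
  shows "(\<integral>z. (p z * w z - q z * r z) * (chi R z * chi R' z) \<partial>lborel)
    \<le> 1 / 4 * (\<integral>z. \<bar>cutoff_div R (\<lambda>z. u z + v z) p q z\<bar> \<partial>lborel)
       * (\<integral>z. \<bar>cutoff_div R' (\<lambda>z. al z + be z) r w z\<bar> \<partial>lborel)"
proof -
  define U where "U = (\<lambda>z. u z * chi R z + p z * dchi R z)"
  define V where "V = (\<lambda>z. v z * chi R z + q z * dchi R (prod.swap z))"
  define A where "A = (\<lambda>z. al z * chi R' z + r z * dchi R' z)"
  define B where "B = (\<lambda>z. be z * chi R' z + w z * dchi R' (prod.swap z))"
  have chisw: "chi R (prod.swap z) = chi R z" for R z by (simp add: chi_def mult.commute)
  \<comment> \<open>The statement for derivatives in the second variable, obtained from that for the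
    first by exchanging the coordinates.\<close>
  have y: "integrable lborel V"
     "AE x in lborel. (\<integral>t. V (x, t) \<partial>lborel) = 0"
     "AE z in lborel. q z * chi R z = (\<integral>t. V (fst z, t) * lt t (snd z) \<partial>lborel)"
    if V: "V = (\<lambda>z. v z * chi R z + q z * dchi R (prod.swap z))" and q: "loc_integrable q" and v: "loc_integrable v"
     and wk: "weak_dx (\<lambda>z. q (prod.swap z)) (\<lambda>z. v (prod.swap z))" and R: "0 < R" for V v q R
  proof -
    note c = cutoff_primitive[OF loc_integrable_swap[OF q] loc_integrable_swap[OF v] wk R]
    have e: "v (prod.swap z) * chi R z + q (prod.swap z) * dchi R z = V (prod.swap z)" for z
      by (simp add: V chisw)
    note c = c[unfolded e]
    have m: "V \<in> borel_measurable borel"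
    proof -
      have "(\<lambda>z. V (prod.swap z)) \<in> borel_measurable borel"
        using borel_measurable_integrable[OF c(2)] by simp
      from measurable_compose[OF _ this, of prod.swap borel] show ?thesis by simp
    qed
    show "integrable lborel V" using integral_lborel_swap(2)[OF m] c(2) by simp
    show "AE x in lborel. (\<integral>t. V (x, t) \<partial>lborel) = 0" using c(3) by simp
    show "AE z in lborel. q z * chi R z = (\<integral>t. V (fst z, t) * lt t (snd z) \<partial>lborel)"
      using AE_lborel_swap[OF c(4)] by (simp add: chisw)
  qed
  have cU: "integrable lborel U" "AE y in lborel. (\<integral>s. U (s, y) \<partial>lborel) = 0"
    "AE z in lborel. p z * chi R z = (\<integral>s. U (s, snd z) * lt s (fst z) \<partial>lborel)"
    unfolding U_def by (rule cutoff_primitive(2-4)[OF loc(1,5) weak(1)]; rule R)+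
  have cA: "integrable lborel A" "AE y in lborel. (\<integral>s. A (s, y) \<partial>lborel) = 0"
    "AE z in lborel. r z * chi R' z = (\<integral>s. A (s, snd z) * lt s (fst z) \<partial>lborel)"
    unfolding A_def by (rule cutoff_primitive(2-4)[OF loc(3,7) weak(2)]; rule R)+
  note cV = y[OF V_def loc(2,6) weak(3) R(1)]
  note cB = y[OF B_def loc(4,8) weak(4) R(2)]
  have mV: "V \<in> borel_measurable borel" "A \<in> borel_measurable borel"
    using cV(1) cA(1) by (auto dest: borel_measurable_integrable)
  \<comment> \<open>Truncated components arrive as primitives with \<open>lt\<close>, while the core
    estimate wants \<open>le\<close> for \<open>q r\<close>; the kernels differ at a single
    point.\<close>
  have le_lt: "(\<integral>s. g s * lt s x \<partial>lborel) = (\<integral>s. g s * le s x \<partial>lborel)" if [measurable]: "g \<in> borel_measurable borel" for g x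
  proof (rule integral_cong_AE)
    show "AE s in lborel. g s * lt s x = g s * le s x"
      using AE_lborel_singleton[of x] by eventually_elim (auto simp: lt_def le_def)
  qed measurable
  have V_le: "(\<integral>t. V (x, t) * lt t y \<partial>lborel) = (\<integral>t. V (x, t) * le t y \<partial>lborel)" for x y
    by (rule le_lt, rule measurable_compose[OF _ mV(1)]) (intro borel_measurable_continuous_onI continuous_intros)
  have A_le: "(\<integral>s. A (s, y) * lt s x \<partial>lborel) = (\<integral>s. A (s, y) * le s x \<partial>lborel)" for x y
    by (rule le_lt, rule measurable_compose[OF _ mV(2)]) (intro borel_measurable_continuous_onI continuous_intros)
  have P: "AE z in lborel. 0 \<le> (\<integral>s. U (s, snd z) * lt s (fst z) \<partial>lborel)"
    using cU(3) pos(1)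
  proof eventually_elim
    case (elim z)
    show ?case
      unfolding elim(1)[symmetric] by (rule mult_nonneg_nonneg[OF elim(2) chi_bounds(1)])
  qed
  have W: "AE z in lborel. 0 \<le> (\<integral>t. B (fst z, t) * lt t (snd z) \<partial>lborel)"
    using cB(3) pos(2)
  proof eventually_elim
    case (elim z)
    show ?case
      unfolding elim(1)[symmetric] by (rule mult_nonneg_nonneg[OF elim(2) chi_bounds(1)])
  qed
  note core = integral_det_le_neg_parts[OF cU(1) cV(1) cA(1) cB(1) cU(2) cV(2) cA(2) cB(2) P W]
  have [measurable]: "p \<in> borel_measurable borel" "q \<in> borel_measurable borel" "r \<in> borel_measurable borel" "w \<in> borel_measurable borel"
    "chi R \<in> borel_measurable borel" "chi R' \<in> borel_measurable borel"
    using loc by (auto intro: loc_integrable_measurable borel_measurable_continuous_onI[OF continuous_chi])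
  have bm: "(\<lambda>z. lt (fst z) (snd z)) \<in> borel_measurable borel" "(\<lambda>z. le (fst z) (snd z)) \<in> borel_measurable borel"
    by measurable
  have iprod: "integrable lborel (\<lambda>z. (\<integral>s. U (s, snd z) * lt s (fst z) \<partial>lborel) * (\<integral>t. B (fst z, t) * lt t (snd z) \<partial>lborel))"
    "integrable lborel (\<lambda>z. (\<integral>s. A (s, snd z) * le s (fst z) \<partial>lborel) * (\<integral>t. V (fst z, t) * le t (snd z) \<partial>lborel))"
    using integral_primitives_mult(1)[OF cU(1) cB(1) bm(1) _ bm(1)]
     integral_primitives_mult(1)[OF cA(1) cV(1) bm(2) _ bm(2)] by simp_all
  have "(\<integral>z. (p z * w z - q z * r z) * (chi R z * chi R' z) \<partial>lborel) =
    (\<integral>z. (\<integral>s. U (s, snd z) * lt s (fst z) \<partial>lborel) * (\<integral>t. B (fst z, t) * lt t (snd z) \<partial>lborel)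
     - (\<integral>s. A (s, snd z) * le s (fst z) \<partial>lborel) * (\<integral>t. V (fst z, t) * le t (snd z) \<partial>lborel) \<partial>lborel)"
  proof (rule integral_cong_AE)
    show "AE z in lborel. (p z * w z - q z * r z) * (chi R z * chi R' z) =
      (\<integral>s. U (s, snd z) * lt s (fst z) \<partial>lborel) * (\<integral>t. B (fst z, t) * lt t (snd z) \<partial>lborel)
     - (\<integral>s. A (s, snd z) * le s (fst z) \<partial>lborel) * (\<integral>t. V (fst z, t) * le t (snd z) \<partial>lborel)"
      using cU(3) cB(3) cA(3) cV(3)
    proof eventually_elim
      case (elim z)
      show ?case
        unfolding elim(1,2)[symmetric] A_le[symmetric] V_le[symmetric] elim(3,4)[symmetric] by (simp add: algebra_simps)
    qed
  qed (use borel_measurable_integrable[OF Bochner_Integration.integrable_diff[OF iprod]] in \<open>simp; measurable\<close>)+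
  also note core
  also have "(\<integral>z. max 0 (- (U z + V z)) \<partial>lborel) * (\<integral>z. max 0 (- (A z + B z)) \<partial>lborel) =
    1 / 4 * (\<integral>z. \<bar>cutoff_div R (\<lambda>z. u z + v z) p q z\<bar> \<partial>lborel)
       * (\<integral>z. \<bar>cutoff_div R' (\<lambda>z. al z + be z) r w z\<bar> \<partial>lborel)"
  proof -
    have z1: "integral\<^sup>L lborel h = 0" if "integrable lborel h" "AE y in lborel. (\<integral>s. h (s, y) \<partial>lborel) = 0"
      for h :: "real \<times> real \<Rightarrow> real"
      using that(2) by (subst integrable_lborel_Fubini(2)[OF that(1), symmetric]) (rule integral_eq_zero_AE)
    have z2: "integral\<^sup>L lborel h = 0" if "integrable lborel h" "AE x in lborel. (\<integral>t. h (x, t) \<partial>lborel) = 0"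
      for h :: "real \<times> real \<Rightarrow> real"
      using that(2) by (subst integrable_lborel_Fubini(1)[OF that(1), symmetric]) (rule integral_eq_zero_AE)
    have "integral\<^sup>L lborel U = 0" "integral\<^sup>L lborel A = 0" "integral\<^sup>L lborel V = 0" "integral\<^sup>L lborel B = 0"
      by (rule z1[OF cU(1,2)] z1[OF cA(1,2)] z2[OF cV(1,2)] z2[OF cB(1,2)])+
    then have n: "(\<integral>z. max 0 (- (U z + V z)) \<partial>lborel) = (\<integral>z. \<bar>U z + V z\<bar> \<partial>lborel) / 2"
      "(\<integral>z. max 0 (- (A z + B z)) \<partial>lborel) = (\<integral>z. \<bar>A z + B z\<bar> \<partial>lborel) / 2"
      using cU(1) cV(1) cA(1) cB(1) by (intro integral_neg_part; simp)+
    have "U z + V z = cutoff_div R (\<lambda>z. u z + v z) p q z" "A z + B z = cutoff_div R' (\<lambda>z. al z + be z) r w z" for z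
      by (simp_all add: U_def V_def A_def B_def cutoff_div_def algebra_simps)
    then show ?thesis unfolding n by simp
  qed
  finally show ?thesis .
qed

section \<open>Removing the truncation\<close>

lemma chi_tendsto_1: "(\<lambda>n. chi (real (Suc n)) z) \<longlonglongrightarrow> 1"
proof -
  have "(\<lambda>n. bump (1 / real (Suc n) * t + 0)) \<longlonglongrightarrow> bump 0" for t
  proof (rule isCont_tendsto_compose[of 0 bump])
    show "isCont bump 0" by (rule DERIV_isCont[OF smooth_deriv(1)[OF smooth_bump]])
    show "(\<lambda>n. 1 / real (Suc n) * t + 0) \<longlonglongrightarrow> 0"
      using tendsto_mult_left_zero[OF LIMSEQ_Suc[OF lim_1_over_n], of t] by simp
  qed
  then show ?thesis
    using tendsto_mult[of "\<lambda>n. cutoff (real (Suc n)) (fst z)" 1 sequentially "\<lambda>n. cutoff (real (Suc n)) (snd z)" 1]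
    by (simp add: chi_def cutoff_def bump_0)
qed

text \<open>
  The gradient of the cutoff is of order \<open>1 / R\<close> on a square of area \<open>4 R\<^sup>2\<close>, so
  plain Cauchy--Schwarz only gives boundedness; the limit vanishes because \<open>deriv bump 0 = 0\<close>.
\<close>

lemma dchi_L1_tendsto_0:
  fixes p :: "real \<times> real \<Rightarrow> real"
  assumes pm: "p \<in> borel_measurable borel" and p2: "integrable lborel (\<lambda>z. (p z)\<^sup>2)"
  shows "(\<lambda>n. \<integral>z. \<bar>p z * dchi (real (Suc n)) z\<bar> \<partial>lborel) \<longlonglongrightarrow> 0"
proof -
  obtain M where M: "\<And>t. \<bar>deriv bump t\<bar> \<le> M" using deriv_bump_bounded by blast
  have M0: "0 \<le> M" using M[of 0] by simp
  \<comment> \<open>Up to the factor 1/R, \<open>a n\<close> bounds the derivative of the cutoff. It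
    is bounded by \<open>M\<close> and tends pointwise to \<open>deriv bump 0\<close>, so dominated
    convergence makes \<open>E n\<close> small.\<close>
  define a where "a n z = deriv bump (fst z / real (Suc n))" for n and z :: "real \<times> real"
  define E where "E n = (\<integral>z. (p z)\<^sup>2 * (a n z)\<^sup>2 \<partial>lborel)" for n
  have [measurable]: "(fst :: (real \<times> real) \<Rightarrow> _) \<in> borel \<rightarrow>\<^sub>M borel"
    "p \<in> borel_measurable borel" "deriv bump \<in> borel_measurable borel"
    using pm smooth_measurable[OF smooth_deriv(2)[OF smooth_bump]] by (auto intro!: borel_measurable_continuous_onI continuous_intros)
  have [measurable]: "dchi R \<in> borel_measurable borel" for R
    by (intro borel_measurable_continuous_onI continuous_dchi)
  have am [measurable]: "a n \<in> borel_measurable borel" for n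
    unfolding a_def by measurable
  have a2: "(a n z)\<^sup>2 \<le> M\<^sup>2" for n z
    unfolding a_def using M by (metis abs_ge_zero power2_abs power_mono)
  have iE: "integrable lborel (\<lambda>z. (p z)\<^sup>2 * (a n z)\<^sup>2)" for n
  proof (rule Bochner_Integration.integrable_bound)
    show "integrable lborel (\<lambda>z. M\<^sup>2 * (p z)\<^sup>2)" using p2 by simp
    show "AE z in lborel. norm ((p z)\<^sup>2 * (a n z)\<^sup>2) \<le> norm (M\<^sup>2 * (p z)\<^sup>2)"
      using mult_right_mono[OF a2, of "(p _)\<^sup>2"] by (intro AE_I2) (simp add: abs_mult mult.commute)
  qed measurable
  have "E \<longlonglongrightarrow> (\<integral>z. (p z)\<^sup>2 * 0 \<partial>lborel)"
    unfolding E_def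
  proof (rule integral_dominated_convergence[where w = "\<lambda>z. M\<^sup>2 * (p z)\<^sup>2"])
    show "integrable lborel (\<lambda>z. M\<^sup>2 * (p z)\<^sup>2)" using p2 by simp
    show "AE z in lborel. norm ((p z)\<^sup>2 * (a n z)\<^sup>2) \<le> M\<^sup>2 * (p z)\<^sup>2" for n
      using mult_right_mono[OF a2, of "(p _)\<^sup>2"] by (intro AE_I2) (simp add: abs_mult mult.commute)
    have "(\<lambda>n. a n z) \<longlonglongrightarrow> deriv bump 0" for z
      unfolding a_def
    proof (rule isCont_tendsto_compose[of 0 "deriv bump"])
      show "isCont (deriv bump) 0" by (rule DERIV_isCont[OF smooth_deriv(1)[OF smooth_deriv(2)[OF smooth_bump]]])
      show "(\<lambda>n. fst z / real (Suc n)) \<longlonglongrightarrow> 0"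
        by (rule LIMSEQ_Suc[OF lim_const_over_n])
    qed
    then have "(\<lambda>n. (p z)\<^sup>2 * (a n z)\<^sup>2) \<longlonglongrightarrow> (p z)\<^sup>2 * (deriv bump 0)\<^sup>2" for z
      by (intro tendsto_intros)
    then show "AE z in lborel. (\<lambda>n. (p z)\<^sup>2 * (a n z)\<^sup>2) \<longlonglongrightarrow> (p z)\<^sup>2 * 0"
      by (simp add: deriv_bump_0)
  qed measurable
  then have E: "E \<longlonglongrightarrow> 0" by simp
  have E0: "0 \<le> E n" for n unfolding E_def by (rule integral_nonneg_AE) auto
  \<comment> \<open>The weight in the inequality x y \<le> d y^2 + x^2 / d, used with y = 1/R on a
    square of area 4 R^2. It makes the two terms at most 4 d and \<open>sqrt (E n)\<close>, both
    tending to 0; the summand 1/(n+1) keeps the weight positive when \<open>E n = 0\<close>.\<close>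
  define d where "d n = sqrt (E n) + 1 / real (Suc n)" for n
  have d: "0 < d n" for n using E0[of n] by (simp add: d_def add_nonneg_pos)
  have sq: "0 < real (Suc n)" for n by simp
  have isq: "integrable lborel (\<lambda>z. indicator (square R) z :: real)" "(\<integral>z. indicator (square R) z \<partial>lborel) = 4 * R\<^sup>2" if "0 < R" for R
  proof -
    show "integrable lborel (\<lambda>z. indicator (square R) z :: real)"
      by (rule integrable_real_indicator) (simp, rule emeasure_lborel_cbox_finite)
    show "(\<integral>z. indicator (square R) z \<partial>lborel) = 4 * R\<^sup>2"
      using that by (simp add: content_Pair power2_eq_square)
  qed
  have bound: "(\<integral>z. \<bar>p z * dchi (real (Suc n)) z\<bar> \<partial>lborel) \<le> 4 * d n + sqrt (E n)" for n
  proof -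
    let ?R = "real (Suc n)"
    have "(\<integral>z. \<bar>p z * dchi ?R z\<bar> \<partial>lborel) \<le> (\<integral>z. d n / ?R\<^sup>2 * indicator (square ?R) z + 1 / d n * ((p z)\<^sup>2 * (a n z)\<^sup>2) \<partial>lborel)"
    proof (rule integral_mono_AE')
      show "integrable lborel (\<lambda>z. d n / ?R\<^sup>2 * indicator (square ?R) z + 1 / d n * ((p z)\<^sup>2 * (a n z)\<^sup>2))"
        using isq(1)[OF sq] iE by simp
      show "AE z in lborel. \<bar>p z * dchi ?R z\<bar> \<le> d n / ?R\<^sup>2 * indicator (square ?R) z + 1 / d n * ((p z)\<^sup>2 * (a n z)\<^sup>2)"
      proof (rule AE_I2)
        fix z
        show "\<bar>p z * dchi ?R z\<bar> \<le> d n / ?R\<^sup>2 * indicator (square ?R) z + 1 / d n * ((p z)\<^sup>2 * (a n z)\<^sup>2)"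
        proof (cases "z \<in> square ?R")
          case True
          have "\<bar>dchi ?R z\<bar> \<le> \<bar>a n z\<bar> * (1 / ?R)"
            using cutoff_nonneg[of ?R "snd z"] cutoff_le_1[of ?R "snd z"]
            by (simp add: dchi_def deriv_cutoff a_def abs_mult mult_left_le divide_simps del: of_nat_Suc)
          then have "\<bar>p z * dchi ?R z\<bar> \<le> \<bar>p z\<bar> * (\<bar>a n z\<bar> * (1 / ?R))"
            unfolding abs_mult by (rule mult_left_mono) simp
          also have "\<dots> = \<bar>p z * a n z\<bar> * (1 / ?R)" by (simp add: abs_mult)
          also have "\<dots> \<le> d n * (1 / ?R)\<^sup>2 + 1 / d n * (\<bar>p z * a n z\<bar>)\<^sup>2"
          proof -
            have "x * y \<le> e * y\<^sup>2 + 1 / e * x\<^sup>2" if "0 < e" "0 \<le> x" "0 \<le> y" for x y e :: real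
            proof -
              have "0 \<le> (e * y - x)\<^sup>2 + e * (x * y)" using that by simp
              then have "e * (x * y) \<le> e\<^sup>2 * y\<^sup>2 + x\<^sup>2"
                by (simp add: power2_eq_square algebra_simps)
              also have "\<dots> = e * (e * y\<^sup>2 + 1 / e * x\<^sup>2)"
                using that by (simp add: power2_eq_square field_simps)
              finally show ?thesis using that by simp
            qed
            from this[OF d[of n], of "\<bar>p z * a n z\<bar>" "1 / ?R"] show ?thesis by (simp del: of_nat_Suc)
          qed
          finally show ?thesis using True by (simp add: power_mult_distrib power_divide)
        next
          case False
          then show ?thesis
            using dchi_eq_0[OF sq not_in_square[OF False]] d[of n] by simp
        qed
      qed
      show "AE z in lborel. 0 \<le> d n / ?R\<^sup>2 * indicator (square ?R) z + 1 / d n * ((p z)\<^sup>2 * (a n z)\<^sup>2)"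
        using less_imp_le[OF d[of n]] by (intro AE_I2 add_nonneg_nonneg mult_nonneg_nonneg divide_nonneg_nonneg) auto
    qed
    also have "\<dots> = d n / ?R\<^sup>2 * (4 * ?R\<^sup>2) + 1 / d n * E n"
      using isq[OF sq] iE unfolding E_def by (subst Bochner_Integration.integral_add) (simp_all del: of_nat_Suc)
    also have "\<dots> \<le> 4 * d n + sqrt (E n)"
    proof -
      have "E n / d n \<le> sqrt (E n)"
      proof -
        have "E n = sqrt (E n) * sqrt (E n)" using E0 by simp
        also have "\<dots> \<le> sqrt (E n) * d n" using E0 by (intro mult_left_mono) (auto simp: d_def)
        finally show ?thesis using d by (simp add: pos_divide_le_eq)
      qed
      then show ?thesis by (simp del: of_nat_Suc)
    qed
    finally show ?thesis .
  qed
  have "(\<lambda>n. 4 * d n + sqrt (E n)) \<longlonglongrightarrow> 4 * (sqrt 0 + 0) + sqrt 0"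
    unfolding d_def by (intro tendsto_intros E LIMSEQ_Suc[OF lim_1_over_n])
  then have *: "(\<lambda>n. 4 * d n + sqrt (E n)) \<longlonglongrightarrow> 0" by simp
  show ?thesis
  proof (rule tendsto_sandwich[OF _ _ tendsto_const *])
    show "eventually (\<lambda>n. 0 \<le> (\<integral>z. \<bar>p z * dchi (real (Suc n)) z\<bar> \<partial>lborel)) sequentially"
      by (intro always_eventually allI integral_nonneg_AE) auto
    show "eventually (\<lambda>n. (\<integral>z. \<bar>p z * dchi (real (Suc n)) z\<bar> \<partial>lborel) \<le> 4 * d n + sqrt (E n)) sequentially"
      by (intro always_eventually allI bound)
  qed
qed

text \<open>As the cutoff is at most 1, the part with \<open>f\<close> costs nothing beyond the norm
  of \<open>f\<close>. The two gradient terms form the error, which tends to 0 because the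
  components are square integrable.\<close>

lemma cutoff_div_L1_bound:
  fixes f p q :: "real \<times> real \<Rightarrow> real"
  assumes f: "integrable lborel f" and p: "loc_integrable p" "integrable lborel (\<lambda>z. (p z)\<^sup>2)"
    and q: "loc_integrable q" "integrable lborel (\<lambda>z. (q z)\<^sup>2)"
  obtains e where "e \<longlonglongrightarrow> 0" "\<And>n. (\<integral>z. \<bar>cutoff_div (real (Suc n)) f p q z\<bar> \<partial>lborel) \<le> (\<integral>z. \<bar>f z\<bar> \<partial>lborel) + e n"
proof
  let ?q = "\<lambda>z. q (prod.swap z)"
  let ?e = "\<lambda>n. (\<integral>z. \<bar>p z * dchi (real (Suc n)) z\<bar> \<partial>lborel) + (\<integral>z. \<bar>?q z * dchi (real (Suc n)) z\<bar> \<partial>lborel)"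
  note pm = loc_integrable_measurable[OF p(1)] and qm = loc_integrable_measurable[OF q(1)]
    and sq = loc_integrable_swap[OF q(1)]
  have q2: "integrable lborel (\<lambda>z. (?q z)\<^sup>2)"
    using integral_lborel_swap(2)[of "\<lambda>z. (q z)\<^sup>2"] qm q(2) by simp
  show "?e \<longlonglongrightarrow> 0"
    using tendsto_add[OF dchi_L1_tendsto_0[OF pm p(2)] dchi_L1_tendsto_0[OF loc_integrable_measurable[OF sq] q2]] by simp
  fix n
  let ?R = "real (Suc n)"
  have R: "0 < ?R" by simp
  have mchi: "chi ?R \<in> borel_measurable lborel" "dchi ?R \<in> borel_measurable borel"
    by (auto intro!: borel_measurable_continuous_onI continuous_chi continuous_dchi)
  have i1: "integrable lborel (\<lambda>z. f z * chi ?R z)"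
    using chi_bounds by (intro integrable_mult_bounded1[OF f mchi(1)]) simp
  have i2: "integrable lborel (\<lambda>z. p z * dchi ?R z)"
    by (rule loc_integrable_mult[OF p(1) continuous_dchi R]) (erule dchi_eq_0[OF R])
  have i3: "integrable lborel (\<lambda>z. ?q z * dchi ?R z)"
    by (rule loc_integrable_mult[OF sq continuous_dchi R]) (erule dchi_eq_0[OF R])
  have m: "(\<lambda>z. q z * dchi ?R (prod.swap z)) \<in> borel_measurable borel"
    using qm mchi(2) by measurable
  have i4: "integrable lborel (\<lambda>z. q z * dchi ?R (prod.swap z))"
    using integral_lborel_swap(2)[OF m] i3 by simp
  have e4: "(\<integral>z. \<bar>q z * dchi ?R (prod.swap z)\<bar> \<partial>lborel) = (\<integral>z. \<bar>?q z * dchi ?R z\<bar> \<partial>lborel)"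
    using integral_lborel_swap(1)[of "\<lambda>z. \<bar>q z * dchi ?R (prod.swap z)\<bar>"] m by simp
  have "(\<integral>z. \<bar>cutoff_div ?R f p q z\<bar> \<partial>lborel) \<le> (\<integral>z. \<bar>f z\<bar> + \<bar>p z * dchi ?R z\<bar> + \<bar>q z * dchi ?R (prod.swap z)\<bar> \<partial>lborel)"
  proof (rule integral_mono)
    show "integrable lborel (\<lambda>z. \<bar>cutoff_div ?R f p q z\<bar>)"
      unfolding cutoff_div_def using i1 i2 i4 by simp
    show "integrable lborel (\<lambda>z. \<bar>f z\<bar> + \<bar>p z * dchi ?R z\<bar> + \<bar>q z * dchi ?R (prod.swap z)\<bar>)"
      using f i2 i4 by simp
    fix z
    have "\<bar>f z * chi ?R z\<bar> \<le> \<bar>f z\<bar>"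
      using chi_bounds[of ?R z] by (simp add: abs_mult mult_left_le)
    then show "\<bar>cutoff_div ?R f p q z\<bar> \<le> \<bar>f z\<bar> + \<bar>p z * dchi ?R z\<bar> + \<bar>q z * dchi ?R (prod.swap z)\<bar>"
      unfolding cutoff_div_def by linarith
  qed
  also have "\<dots> = (\<integral>z. \<bar>f z\<bar> \<partial>lborel) + ?e n"
    using f i2 i4 by (simp add: e4 del: of_nat_Suc)
  finally show "(\<integral>z. \<bar>cutoff_div ?R f p q z\<bar> \<partial>lborel) \<le> (\<integral>z. \<bar>f z\<bar> \<partial>lborel) + ?e n" .
qed

text \<open>
  The two cutoff radii are sent to infinity one after the other: this settles the case where one total divergence is
  0 and the other is infinite, in which the right-hand side is 0.
\<close>

lemma nn_integral_det_le:
  assumes loc: "loc_integrable p" "loc_integrable q" "loc_integrable r" "loc_integrable w"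
      "loc_integrable u" "loc_integrable v" "loc_integrable al" "loc_integrable be"
    and sq: "integrable lborel (\<lambda>z. (p z)\<^sup>2)" "integrable lborel (\<lambda>z. (q z)\<^sup>2)"
      "integrable lborel (\<lambda>z. (r z)\<^sup>2)" "integrable lborel (\<lambda>z. (w z)\<^sup>2)"
    and weak: "weak_dx p u" "weak_dx r al"
      "weak_dx (\<lambda>z. q (prod.swap z)) (\<lambda>z. v (prod.swap z))" "weak_dx (\<lambda>z. w (prod.swap z)) (\<lambda>z. be (prod.swap z))"
    and pos: "AE z in lborel. 0 \<le> p z" "AE z in lborel. 0 \<le> w z"
    and det: "AE z in lborel. 0 \<le> p z * w z - q z * r z"
  shows "(\<integral>\<^sup>+ z. ennreal (p z * w z - q z * r z) \<partial>lborel)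
    \<le> ennreal (1 / 4) * (\<integral>\<^sup>+ z. ennreal \<bar>u z + v z\<bar> \<partial>lborel) * (\<integral>\<^sup>+ z. ennreal \<bar>al z + be z\<bar> \<partial>lborel)"
proof -
  define D where "D = (\<lambda>z. p z * w z - q z * r z)"
  define f where "f = (\<lambda>z. u z + v z)"
  define g where "g = (\<lambda>z. al z + be z)"
  note m [measurable] = loc[THEN loc_integrable_measurable]
  have mchi [measurable]: "chi R \<in> borel_measurable borel" for R
    by (intro borel_measurable_continuous_onI continuous_chi)
  have fm [measurable]: "f \<in> borel_measurable borel" "g \<in> borel_measurable borel"
    unfolding f_def g_def by measurable
  have iprod: "integrable lborel (\<lambda>z. a z * b z)"
    if "integrable lborel (\<lambda>z. (a z)\<^sup>2)" "integrable lborel (\<lambda>z. (b z)\<^sup>2)"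
      and [measurable]: "a \<in> borel_measurable borel" "b \<in> borel_measurable borel" for a b :: "real \<times> real \<Rightarrow> real"
  proof (rule Bochner_Integration.integrable_bound)
    show "integrable lborel (\<lambda>z. (a z)\<^sup>2 + (b z)\<^sup>2)" using that by simp
    have "\<bar>x * y\<bar> \<le> x\<^sup>2 + y\<^sup>2" for x y :: real
    proof -
      have "\<bar>x * y\<bar> \<le> 2 * \<bar>x * y\<bar>" by simp
      also have "\<dots> \<le> x\<^sup>2 + y\<^sup>2"
        using sum_squares_bound[of "\<bar>x\<bar>" "\<bar>y\<bar>"] by (simp add: abs_mult mult.assoc)
      finally show ?thesis .
    qed
    then show "AE z in lborel. norm (a z * b z) \<le> norm ((a z)\<^sup>2 + (b z)\<^sup>2)"
      by (intro AE_I2) simp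
  qed measurable
  have iD: "integrable lborel D"
    unfolding D_def using iprod[OF sq(1,4)] iprod[OF sq(2,3)] by simp
  define I where "I R = (\<integral>z. D z * chi R z \<partial>lborel)" for R
  define Nf where "Nf R = (\<integral>z. \<bar>cutoff_div R f p q z\<bar> \<partial>lborel)" for R
  define Ng where "Ng R = (\<integral>z. \<bar>cutoff_div R g r w z\<bar> \<partial>lborel)" for R
  have N0: "0 \<le> Nf R" "0 \<le> Ng R" for R
    unfolding Nf_def Ng_def by (auto intro!: integral_nonneg_AE)
  have main: "(\<integral>z. D z * (chi R z * chi R' z) \<partial>lborel) \<le> 1 / 4 * Nf R * Ng R'" if "0 < R" "0 < R'" for R R'
    unfolding D_def Nf_def Ng_def f_def g_def by (rule integral_det_cutoff_le[OF loc weak pos that])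
  have lim: "(\<lambda>n. \<integral>z. D z * (chi (real (Suc n)) z * h z) \<partial>lborel) \<longlonglongrightarrow> (\<integral>z. D z * h z \<partial>lborel)"
    if [measurable]: "h \<in> borel_measurable borel" and h: "\<And>z. \<bar>h z\<bar> \<le> 1" for h
  proof (rule tendsto_integral_bounded_mult[OF iD])
    show "\<bar>chi (real (Suc n)) z * h z\<bar> \<le> 1" for n z
      using chi_bounds[of "real (Suc n)" z] h[of z] by (simp add: abs_mult mult_le_one del: of_nat_Suc)
    show "(\<lambda>n. chi (real (Suc n)) z * h z) \<longlonglongrightarrow> h z" for z
      using tendsto_mult[OF chi_tendsto_1 tendsto_const, of z "h z"] by simp
  qed measurable
  have chi1: "\<bar>chi R z\<bar> \<le> 1" for R z using chi_bounds[of R z] by simp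
  have I: "(\<lambda>n. I (real (Suc n))) \<longlonglongrightarrow> integral\<^sup>L lborel D"
    using lim[of "\<lambda>_. 1"] by (simp add: I_def del: of_nat_Suc)
  have Suc0: "0 < real (Suc n)" for n by simp
  \<comment> \<open>Passage to the limit in one radius: the factor \<open>N\<close> belonging to the
    other field is a fixed real number meanwhile.\<close>
  have limit_le: "L \<le> 1 / 4 * F * N"
    if X: "X \<longlonglongrightarrow> L" and b: "\<And>n. X n \<le> 1 / 4 * M n * N" and e: "e \<longlonglongrightarrow> 0" "\<And>n. M n \<le> F + e n" and N: "0 \<le> N"
    for X M e :: "nat \<Rightarrow> real" and L F N :: real
  proof (rule LIMSEQ_le[OF X])
    show "(\<lambda>n. 1 / 4 * (F + e n) * N) \<longlonglongrightarrow> 1 / 4 * F * N"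
      using tendsto_mult_right[OF tendsto_mult_left[OF tendsto_add[OF tendsto_const e(1)], of "1 / 4" F], of N] by simp
    have "X n \<le> 1 / 4 * (F + e n) * N" for n
      using b[of n] mult_right_mono[OF e(2)[of n] N] by simp
    then show "\<exists>k. \<forall>n\<ge>k. X n \<le> 1 / 4 * (F + e n) * N" by blast
  qed
  \<comment> \<open>The radius of the first field goes to infinity while that of the second stays at
    \<open>R\<close>, so nothing is asked of the integrability of \<open>g\<close>.\<close>
  have If: "I R \<le> 1 / 4 * (\<integral>z. \<bar>f z\<bar> \<partial>lborel) * Ng R" if f: "integrable lborel f" and R: "0 < R" for R
  proof -
    obtain e where e: "e \<longlonglongrightarrow> 0" "\<And>n. Nf (real (Suc n)) \<le> (\<integral>z. \<bar>f z\<bar> \<partial>lborel) + e n"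
      using cutoff_div_L1_bound[OF f loc(1) sq(1) loc(2) sq(2)] unfolding Nf_def by blast
    show ?thesis
      using limit_le[OF lim[OF mchi chi1] main[OF Suc0 R] e N0(2)] by (simp add: I_def)
  qed
  have Ig: "I R \<le> 1 / 4 * (\<integral>z. \<bar>g z\<bar> \<partial>lborel) * Nf R" if g: "integrable lborel g" and R: "0 < R" for R
  proof -
    obtain e where e: "e \<longlonglongrightarrow> 0" "\<And>n. Ng (real (Suc n)) \<le> (\<integral>z. \<bar>g z\<bar> \<partial>lborel) + e n"
      using cutoff_div_L1_bound[OF g loc(3) sq(3) loc(4) sq(4)] unfolding Ng_def by blast
    have "(\<integral>z. D z * (chi (real (Suc n)) z * chi R z) \<partial>lborel) \<le> 1 / 4 * Ng (real (Suc n)) * Nf R" for n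
      using main[OF R Suc0[of n]] by (simp add: mult_ac del: of_nat_Suc)
    from limit_le[OF lim[OF mchi chi1] this e N0(1)] show ?thesis by (simp add: I_def)
  qed
  \<comment> \<open>Nonnegativity of the determinant ensures that \<open>ennreal\<close> cuts
    nothing off, so the extended integral is the ordinary one.\<close>
  have nn: "(\<integral>\<^sup>+ z. ennreal (D z) \<partial>lborel) = ennreal (integral\<^sup>L lborel D)"
    using iD det by (intro nn_integral_eq_integral) (auto simp: D_def)
  have abs_fin: "(\<integral>\<^sup>+ z. ennreal \<bar>h z\<bar> \<partial>lborel) = ennreal (\<integral>z. \<bar>h z\<bar> \<partial>lborel)" if "integrable lborel h" for h :: "real \<times> real \<Rightarrow> real"
    using that by (intro nn_integral_eq_integral) auto
  have abs_inf: "(\<integral>\<^sup>+ z. ennreal \<bar>h z\<bar> \<partial>lborel) = \<infinity>" if "\<not> integrable lborel h" "h \<in> borel_measurable borel" for h :: "real \<times> real \<Rightarrow> real"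
    using that by (auto simp: integrable_iff_bounded less_top[symmetric])
  have zero: "integral\<^sup>L lborel D \<le> 0" if "\<And>R. 0 < R \<Longrightarrow> I R \<le> 0"
    by (rule LIMSEQ_le_const2[OF I]) (use that[OF Suc0] in blast)
  have abs_int0: "0 \<le> (\<integral>z. \<bar>h z\<bar> \<partial>lborel)" for h :: "real \<times> real \<Rightarrow> real"
    by (rule integral_nonneg_AE) auto
  have "(\<integral>\<^sup>+ z. ennreal (D z) \<partial>lborel)
    \<le> ennreal (1 / 4) * (\<integral>\<^sup>+ z. ennreal \<bar>f z\<bar> \<partial>lborel) * (\<integral>\<^sup>+ z. ennreal \<bar>g z\<bar> \<partial>lborel)"
  proof (cases "integrable lborel f")
    case f: True
    show ?thesis
    proof (cases "integrable lborel g")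
      case g: True
      obtain e where e: "e \<longlonglongrightarrow> 0" "\<And>n. Ng (real (Suc n)) \<le> (\<integral>z. \<bar>g z\<bar> \<partial>lborel) + e n"
        using cutoff_div_L1_bound[OF g loc(3) sq(3) loc(4) sq(4)] unfolding Ng_def by blast
      have "I (real (Suc n)) \<le> 1 / 4 * Ng (real (Suc n)) * (\<integral>z. \<bar>f z\<bar> \<partial>lborel)" for n
        using If[OF f Suc0[of n]] by (simp add: mult_ac del: of_nat_Suc)
      from limit_le[OF I this e abs_int0]
      have "integral\<^sup>L lborel D \<le> 1 / 4 * (\<integral>z. \<bar>f z\<bar> \<partial>lborel) * (\<integral>z. \<bar>g z\<bar> \<partial>lborel)" by (simp add: mult_ac)
      then show ?thesis
        unfolding nn abs_fin[OF f] abs_fin[OF g] by (simp add: ennreal_mult'[symmetric] abs_int0 ennreal_leI del: ennreal_divide_numeral)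
    next
      case g: False
      show ?thesis
      proof (cases "(\<integral>z. \<bar>f z\<bar> \<partial>lborel) = 0")
        case True
        \<comment> \<open>In \<open>ennreal\<close> the product of 0 and infinity is 0, so the
          integral of \<open>D\<close> has to be shown nonpositive. At each finite radius
          \<open>Ng R\<close> is a real number, and the factor 0 gives
          \<open>I R \<le> 0\<close>.\<close>
        then have "integral\<^sup>L lborel D \<le> 0" using If[OF f] by (intro zero) simp
        then show ?thesis unfolding nn by (simp add: ennreal_neg)
      next
        case False
        then have "0 < (\<integral>z. \<bar>f z\<bar> \<partial>lborel)" using abs_int0[of f] by linarith
        then show ?thesis
          unfolding abs_inf[OF g fm(2)] abs_fin[OF f] by (simp add: ennreal_mult_top ennreal_mult_eq_top_iff)
      qed
    qed
  next
    case f: False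
    show ?thesis
    proof (cases "integrable lborel g")
      case g: True
      show ?thesis
      proof (cases "(\<integral>z. \<bar>g z\<bar> \<partial>lborel) = 0")
        case True
        then have "integral\<^sup>L lborel D \<le> 0" using Ig[OF g] by (intro zero) simp
        then show ?thesis unfolding nn by (simp add: ennreal_neg)
      next
        case False
        then have "0 < (\<integral>z. \<bar>g z\<bar> \<partial>lborel)" using abs_int0[of g] by linarith
        then show ?thesis
          unfolding abs_inf[OF f fm(1)] abs_fin[OF g] by (simp add: ennreal_mult_top ennreal_mult_eq_top_iff ennreal_top_mult)
      qed
    next
      case g: False
      show ?thesis
        unfolding abs_inf[OF f fm(1)] abs_inf[OF g fm(2)] by (simp add: ennreal_mult_top)
    qed
  qed
  then show ?thesis by (simp add: D_def f_def g_def)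
qed

section \<open>Transfer from vectors to pairs\<close>

text \<open>Every partial derivative of such a product is again such a product, with one factor
  differentiated, or is 0. Hence the induction on \<open>k\<close> runs over all pairs
  \<open>A\<close>, \<open>B\<close>.\<close>

lemma C_k_tensor:
  fixes i j :: "'n::finite"
  assumes "i \<noteq> j" "C1_k k A" "C1_k k B"
  shows "C_k k (\<lambda>w::real ^ 'n. A (w $ i) * B (w $ j))"
    and "k > 0 \<Longrightarrow> partial_deriv i (\<lambda>w::real ^ 'n. A (w $ i) * B (w $ j)) w = deriv A (w $ i) * B (w $ j)"
proof -
  have d: "((\<lambda>w::real ^ 'n. A (w $ i) * B (w $ j)) has_derivative
      (\<lambda>h. A (w $ i) * (h $ j * deriv B (w $ j)) + (h $ i * deriv A (w $ i)) * B (w $ j))) (at w)"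
    if A: "C1_k (Suc k) A" and B: "C1_k (Suc k) B" for k A B w
  proof -
    have "((\<lambda>w::real ^ 'n. A (w $ i)) has_derivative (\<lambda>h. h $ i * deriv A (w $ i))) (at w)"
      by (rule has_derivative_compose[of "\<lambda>w. w $ i", OF _ C1_k_deriv[OF A, unfolded has_field_derivative_def, of "w $ i"], simplified mult.commute])
        (rule bounded_linear_imp_has_derivative[OF bounded_linear_vec_nth])
    moreover have "((\<lambda>w::real ^ 'n. B (w $ j)) has_derivative (\<lambda>h. h $ j * deriv B (w $ j))) (at w)"
      by (rule has_derivative_compose[of "\<lambda>w. w $ j", OF _ C1_k_deriv[OF B, unfolded has_field_derivative_def, of "w $ j"], simplified mult.commute])
        (rule bounded_linear_imp_has_derivative[OF bounded_linear_vec_nth])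
    ultimately show ?thesis by (rule has_derivative_mult)
  qed
  have pd: "partial_deriv l (\<lambda>w::real ^ 'n. A (w $ i) * B (w $ j)) w =
      (if l = i then deriv A (w $ i) * B (w $ j) else if l = j then A (w $ i) * deriv B (w $ j) else 0)"
    if "C1_k (Suc k) A" "C1_k (Suc k) B" for k A B l w
    unfolding partial_deriv_def frechet_derivative_at[OF d[OF that], symmetric]
    using assms(1) by (auto simp: axis_def)
  show "C_k k (\<lambda>w::real ^ 'n. A (w $ i) * B (w $ j))"
    using assms(2,3)
  proof (induction k arbitrary: A B)
    case 0
    then show ?case
      by (auto intro!: continuous_intros intro: continuous_on_compose2[of UNIV])
  next
    case (Suc k)
    have "C_k k (partial_deriv l (\<lambda>w::real ^ 'n. A (w $ i) * B (w $ j)))" for l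
    proof -
      consider "l = i" | "l = j" | "l \<noteq> i" "l \<noteq> j" by blast
      then show ?thesis
      proof cases
        case 1
        then have "partial_deriv l (\<lambda>w::real ^ 'n. A (w $ i) * B (w $ j)) = (\<lambda>w. deriv A (w $ i) * B (w $ j))"
          by (simp add: pd[OF Suc.prems] fun_eq_iff)
        then show ?thesis using Suc C1_k_mono by simp
      next
        case 2
        then have "partial_deriv l (\<lambda>w::real ^ 'n. A (w $ i) * B (w $ j)) = (\<lambda>w. A (w $ i) * deriv B (w $ j))"
          using assms(1) by (simp add: pd[OF Suc.prems] fun_eq_iff)
        then show ?thesis using Suc C1_k_mono by simp
      next
        case 3
        \<comment> \<open>Zero is written as a product of constants to fit the induction
          hypothesis.\<close>
        then have "partial_deriv l (\<lambda>w::real ^ 'n. A (w $ i) * B (w $ j)) = (\<lambda>w. 0 * 0)"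
          by (simp add: pd[OF Suc.prems] fun_eq_iff)
        then show ?thesis using Suc.IH[OF C1_k_const[of k 0] C1_k_const[of k 0]] by simp
      qed
    qed
    then show ?case using d[OF Suc.prems] by (auto simp: differentiable_def)
  qed
  show "partial_deriv i (\<lambda>w::real ^ 'n. A (w $ i) * B (w $ j)) w = deriv A (w $ i) * B (w $ j)" if "k > 0"
    using pd[of "k - 1" A B i w] assms(2,3) that by simp
qed

text \<open>In the plane the two coordinates exhaust all directions, so bounded supports of both
  factors give a bounded support of the product.\<close>

lemma test_function_tensor:
  fixes i j :: 2
  assumes ij: "i \<noteq> j" and A: "smooth A" and B: "smooth B"
    and supp: "\<And>t. \<bar>t\<bar> \<ge> R \<Longrightarrow> A t = 0 \<and> B t = 0"
  shows "test_function (\<lambda>w. A (w $ i) * B (w $ j))"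
    and "partial_deriv i (\<lambda>w::real ^ 2. A (w $ i) * B (w $ j)) w = deriv A (w $ i) * B (w $ j)"
proof -
  have U: "UNIV = {i, j}" using ij exhaust_2[of i] exhaust_2[of j] by (auto simp: UNIV_2)
  have "{w::real ^ 2. A (w $ i) * B (w $ j) \<noteq> 0} \<subseteq> cbox (\<chi> k. - R) (\<chi> k. R)"
  proof
    fix w :: "real ^ 2" assume "w \<in> {w. A (w $ i) * B (w $ j) \<noteq> 0}"
    then have "\<bar>w $ i\<bar> < R" "\<bar>w $ j\<bar> < R" using supp[of "w $ i"] supp[of "w $ j"] by force+
    moreover have "k = i \<or> k = j" for k :: 2 using U by auto
    ultimately have "\<bar>w $ k\<bar> < R" for k by metis
    then show "w \<in> cbox (\<chi> k. - R) (\<chi> k. R)"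
      by (auto simp: mem_box_cart abs_less_iff less_imp_le minus_less_iff)
  qed
  then have "compact (closure {w::real ^ 2. A (w $ i) * B (w $ j) \<noteq> 0})"
    unfolding compact_closure by (rule bounded_subset[OF bounded_cbox])
  then show "test_function (\<lambda>w. A (w $ i) * B (w $ j))"
    unfolding test_function_def using C_k_tensor(1)[OF ij] A B by (simp add: smooth_def)
  show "partial_deriv i (\<lambda>w::real ^ 2. A (w $ i) * B (w $ j)) w = deriv A (w $ i) * B (w $ j)"
    by (rule C_k_tensor(2)[OF ij, of 1]) (use A B in \<open>simp_all add: smooth_def del: C1_k.simps\<close>)
qed

section \<open>Identification of the plane with pairs of reals\<close>

definition vec_of_pair :: "real \<times> real \<Rightarrow> real ^ 2" where
  "vec_of_pair z = vector [fst z, snd z]"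

lemma vec_of_pair_nth [simp]: "vec_of_pair z $ 1 = fst z" "vec_of_pair z $ 2 = snd z"
  by (simp_all add: vec_of_pair_def)

lemma measurable_vec_of_pair [measurable]: "vec_of_pair \<in> borel_measurable borel"
proof (rule borel_measurable_continuous_onI)
  have "continuous_on UNIV (\<lambda>z. \<chi> i. vec_of_pair z $ i)"
  proof (rule continuous_on_vec_lambda)
    show "continuous_on UNIV (\<lambda>z. vec_of_pair z $ i)" for i
      using exhaust_2[of i] by (elim disjE) (simp_all add: continuous_on_fst continuous_on_snd)
  qed
  then show "continuous_on UNIV vec_of_pair" by simp
qed

text \<open>The map relabels coordinates, hence preserves boxes and their side lengths, and these
  determine \<open>lborel\<close>.\<close>

lemma distr_vec_of_pair: "distr lborel borel vec_of_pair = lborel"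
proof (rule lborel_eqI[symmetric])
  fix l u :: "real ^ 2"
  assume le: "\<And>b. b \<in> Basis \<Longrightarrow> l \<bullet> b \<le> u \<bullet> b"
  have lei: "l $ i \<le> u $ i" for i
    using le[of "axis i 1"] by (simp add: inner_axis axis_in_Basis_iff)
  have B: "(Basis :: (real ^ 2) set) = (\<lambda>i. axis i 1) ` UNIV"
    by (auto simp: Basis_vec_def)
  have inj: "inj (\<lambda>i::2. axis i (1::real))" by (auto simp: inj_on_def axis_eq_axis)
  have "vec_of_pair -` box l u = box (l $ 1, l $ 2) (u $ 1, u $ 2)"
    by (auto simp: mem_box_cart forall_2 box_def[of "(_, _)"] Basis_prod_def)
  then have "emeasure (distr lborel borel vec_of_pair) (box l u) = emeasure lborel (box (l $ 1, l $ 2) (u $ 1, u $ 2))"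
    by (simp add: emeasure_distr)
  also have "\<dots> = (\<Prod>b\<in>Basis. ((u $ 1, u $ 2) - (l $ 1, l $ 2)) \<bullet> b)"
    using lei by (intro emeasure_lborel_box) (auto simp: Basis_prod_def)
  also have "(\<Prod>b\<in>Basis. ((u $ 1, u $ 2) - (l $ 1, l $ 2)) \<bullet> b) = (\<Prod>b\<in>Basis. (u - l) \<bullet> b)"
    unfolding B prod.reindex[OF inj] by (simp add: Basis_prod_def UNIV_2 inner_axis)
  finally show "emeasure (distr lborel borel vec_of_pair) (box l u) = (\<Prod>b\<in>Basis. (u - l) \<bullet> b)" .
qed simp

lemma locally_integrable_borel_measurable:
  fixes f :: "real ^ 'n \<Rightarrow> real"
  assumes "locally_integrable f" shows "f \<in> borel_measurable lebesgue"
proof (rule borel_measurable_LIMSEQ_metric)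
  show "(\<lambda>z. indicator (cball 0 (real n)) z *\<^sub>R f z) \<in> borel_measurable lebesgue" for n
    by (rule borel_measurable_integrable[OF assms[unfolded locally_integrable_def set_integrable_def, rule_format, OF compact_cball]])
  show "(\<lambda>n. indicator (cball 0 (real n)) z *\<^sub>R f z) \<longlonglongrightarrow> f z" for z
  proof -
    obtain N where N: "norm z \<le> real N" using real_arch_simple by blast
    have "z \<in> cball 0 (real n)" if "n \<ge> N" for n
      using N of_nat_mono[OF that, where 'a = real] by simp
    then show ?thesis by (intro tendsto_eventually eventually_sequentiallyI[of N]) auto
  qed
qed

text \<open>The parametrisation \<open>e\<close> is left general: \<open>vec_of_pair\<close> turns
  the first partial derivative into \<open>weak_dx\<close>, and \<open>vec_of_pair\<close> after
  \<open>prod.swap\<close> does so for the second. Borel versions are taken because the computation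
  on pairs uses \<open>lborel\<close>, while the given functions are only Lebesgue
  measurable.\<close>

lemma weak_partial_planar:
  fixes F G :: "real ^ 2 \<Rightarrow> real" and e :: "real \<times> real \<Rightarrow> real ^ 2" and i j :: 2
  assumes w: "has_weak_partial i F G" and ij: "i \<noteq> j"
    and F'm: "F' \<in> borel_measurable borel" and G'm: "G' \<in> borel_measurable borel"
    and F': "AE x in lborel. F x = F' x" and G': "AE x in lborel. G x = G' x"
    and em: "e \<in> borel_measurable borel" and e: "distr lborel borel e = lborel"
    and ei: "\<And>z. e z $ i = fst z" and ej: "\<And>z. e z $ j = snd z"
  shows "weak_dx (\<lambda>z. F' (e z)) (\<lambda>z. G' (e z))"
    and "loc_integrable (\<lambda>z. F' (e z))" "loc_integrable (\<lambda>z. G' (e z))"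
proof -
  note [measurable] = F'm G'm em
  have meas: "F \<in> borel_measurable lebesgue" "G \<in> borel_measurable lebesgue"
    using w locally_integrable_borel_measurable by (auto simp: has_weak_partial_def)
  have nth [measurable]: "(\<lambda>w::real ^ 2. w $ k) \<in> borel_measurable borel" for k
    by (intro borel_measurable_continuous_onI continuous_intros)
  have transfer: "(\<integral>x. H x * c x \<partial>lebesgue) = (\<integral>z. H' (e z) * c (e z) \<partial>lborel)"
    if H: "H \<in> borel_measurable lebesgue" "AE x in lborel. H x = H' x" "H' \<in> borel_measurable borel" and c: "c \<in> borel_measurable borel"
    for H H' c :: "real ^ 2 \<Rightarrow> real"
  proof -
    have c': "c \<in> borel_measurable lebesgue" and H': "H' \<in> borel_measurable lebesgue"
      using c H(3) by (auto intro: measurable_completion)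
    have "(\<integral>x. H x * c x \<partial>lebesgue) = (\<integral>x. H' x * c x \<partial>lebesgue)"
    proof (rule integral_cong_AE)
      show "(\<lambda>x. H x * c x) \<in> borel_measurable lebesgue" "(\<lambda>x. H' x * c x) \<in> borel_measurable lebesgue"
        by (intro borel_measurable_times H(1) c' H')+
      show "AE x in lebesgue. H x * c x = H' x * c x"
        using AE_completion[OF H(2)] by eventually_elim simp
    qed
    also have "\<dots> = (\<integral>x. H' x * c x \<partial>lborel)"
      using H(3) c by (intro integral_completion) auto
    also have "\<dots> = (\<integral>x. H' x * c x \<partial>distr lborel borel e)" by (simp add: e)
    also have "\<dots> = (\<integral>z. H' (e z) * c (e z) \<partial>lborel)"
      using H(3) c by (intro integral_distr) auto
    finally show ?thesis .
  qed
  show "weak_dx (\<lambda>z. F' (e z)) (\<lambda>z. G' (e z))"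
    unfolding weak_dx_def
  proof (intro allI impI)
    fix A B :: "real \<Rightarrow> real"
    assume A: "smooth A" and B: "smooth B" and "\<exists>R. \<forall>t. R \<le> \<bar>t\<bar> \<longrightarrow> A t = 0 \<and> B t = 0"
    then obtain R where R: "\<And>t. R \<le> \<bar>t\<bar> \<Longrightarrow> A t = 0 \<and> B t = 0" by blast
    have tf: "test_function (\<lambda>w. A (w $ i) * B (w $ j))"
      by (rule test_function_tensor(1)[OF ij A B]) (erule R)
    have pd: "partial_deriv i (\<lambda>w::real ^ 2. A (w $ i) * B (w $ j)) = (\<lambda>w. deriv A (w $ i) * B (w $ j))"
      by (rule ext, rule test_function_tensor(2)[OF ij A B]) (erule R)
    have [measurable]: "A \<in> borel_measurable borel" "B \<in> borel_measurable borel" "deriv A \<in> borel_measurable borel"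
      by (intro smooth_measurable A B smooth_deriv(2))+
    have "(\<integral>z. F' (e z) * (deriv A (fst z) * B (snd z)) \<partial>lborel) = (\<integral>x. F x * (deriv A (x $ i) * B (x $ j)) \<partial>lebesgue)"
      by (subst transfer[OF meas(1) F' F'm]) (simp_all add: ei ej)
    also have "\<dots> = - (\<integral>x. G x * (A (x $ i) * B (x $ j)) \<partial>lebesgue)"
      using conjunct2[OF conjunct2[OF w[unfolded has_weak_partial_def]], rule_format, OF tf] unfolding pd .
    also have "\<dots> = - (\<integral>z. G' (e z) * (A (fst z) * B (snd z)) \<partial>lborel)"
      by (subst transfer[OF meas(2) G' G'm]) (simp_all add: ei ej)
    finally show "(\<integral>z. F' (e z) * (deriv A (fst z) * B (snd z)) \<partial>lborel) = - (\<integral>z. G' (e z) * (A (fst z) * B (snd z)) \<partial>lborel)" .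
  qed
  have loc: "loc_integrable (\<lambda>z. H' (e z))"
    if H: "locally_integrable H" "AE x in lborel. H x = H' x" "H' \<in> borel_measurable borel"
    for H H' :: "real ^ 2 \<Rightarrow> real"
    unfolding loc_integrable_def
  proof
    fix R :: real
    let ?K = "cbox (\<chi> k. - R) (\<chi> k. R) :: (real ^ 2) set"
    have i1: "integrable lebesgue (\<lambda>x. indicator ?K x *\<^sub>R H x)"
      by (rule H(1)[unfolded locally_integrable_def set_integrable_def, rule_format, OF compact_cbox])
    have "(\<lambda>x. indicator ?K x *\<^sub>R H' x) \<in> borel_measurable lborel" using H(3) by simp
    then have H'l: "(\<lambda>x. indicator ?K x *\<^sub>R H' x) \<in> borel_measurable lebesgue" by (rule measurable_completion)
    have "AE x in lebesgue. indicator ?K x *\<^sub>R H x = indicator ?K x *\<^sub>R H' x"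
      using AE_completion[OF H(2)] by eventually_elim simp
    then have "integrable lebesgue (\<lambda>x. indicator ?K x *\<^sub>R H' x)"
      by (rule integrable_cong_AE_imp[OF i1 H'l])
    then have "integrable lborel (\<lambda>x. indicator ?K x *\<^sub>R H' x)"
      using H(3) by (subst (asm) integrable_completion) auto
    then have "integrable (distr lborel borel e) (\<lambda>x. indicator ?K x *\<^sub>R H' x)" by (simp add: e)
    then have "integrable lborel (\<lambda>z. indicator ?K (e z) *\<^sub>R H' (e z))"
      using H(3) by (subst (asm) integrable_distr_eq) auto
    moreover have "indicator ?K (e z) = (indicator (square R) z :: real)" for z
    proof -
      have "(\<forall>k. P k) \<longleftrightarrow> P i \<and> P j" for P :: "2 \<Rightarrow> bool"
        using ij by (metis exhaust_2)
      then show ?thesis by (cases z) (auto simp: indicator_def mem_box_cart cbox_Pair_eq ei ej)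
    qed
    ultimately show "integrable lborel (\<lambda>z. indicator (square R) z * H' (e z))" by simp
  qed
  show "loc_integrable (\<lambda>z. F' (e z))" "loc_integrable (\<lambda>z. G' (e z))"
    using w loc[OF _ F' F'm] loc[OF _ G' G'm] by (auto simp: has_weak_partial_def)
qed

lemma square_integrable_vec_of_pair:
  fixes F :: "real ^ 2 \<Rightarrow> real"
  assumes F: "square_integrable F" and F': "AE x in lborel. F x = F' x" and F'm: "F' \<in> borel_measurable borel"
  shows "integrable lborel (\<lambda>z. (F' (vec_of_pair z))\<^sup>2)"
proof -
  have F'l: "F' \<in> borel_measurable lebesgue" using F'm by (auto intro: measurable_completion)
  have "integrable lebesgue (\<lambda>x. (F' x)\<^sup>2)"
    by (rule integrable_cong_AE_imp[of _ "\<lambda>x. (F x)\<^sup>2"]) (use F F'l AE_completion[OF F'] in \<open>auto simp: square_integrable_def\<close>)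
  then have "integrable (distr lborel borel vec_of_pair) (\<lambda>x. (F' x)\<^sup>2)"
    using F'm by (subst (asm) integrable_completion) (auto simp: distr_vec_of_pair)
  then show ?thesis
    using F'm by (subst (asm) integrable_distr_eq) auto
qed

lemma AE_vec_of_pair:
  assumes "AE x in lborel. P x" shows "AE z in lborel. P (vec_of_pair z)"
proof -
  have "AE x in distr lborel borel vec_of_pair. P x" unfolding distr_vec_of_pair by (rule assms)
  then show ?thesis by (rule AE_distrD[rotated]) simp
qed

lemma nn_integral_vec_of_pair:
  fixes H :: "real ^ 2 \<Rightarrow> real"
  assumes "AE x in lborel. H x = H' x" "H' \<in> borel_measurable borel"
  shows "(\<integral>\<^sup>+ x. ennreal (H x) \<partial>lebesgue) = (\<integral>\<^sup>+ z. ennreal (H' (vec_of_pair z)) \<partial>lborel)"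
proof -
  have "(\<integral>\<^sup>+ x. ennreal (H x) \<partial>lebesgue) = (\<integral>\<^sup>+ x. ennreal (H' x) \<partial>lebesgue)"
    by (rule nn_integral_cong_AE) (use AE_completion[OF assms(1)] in auto)
  also have "\<dots> = (\<integral>\<^sup>+ x. ennreal (H' x) \<partial>distr lborel borel vec_of_pair)"
    using assms(2) by (simp add: nn_integral_completion distr_vec_of_pair)
  also have "\<dots> = (\<integral>\<^sup>+ z. ennreal (H' (vec_of_pair z)) \<partial>lborel)"
    using assms(2) by (intro nn_integral_distr) auto
  finally show ?thesis .
qed

lemma vec_of_pair_swap: "distr lborel borel (\<lambda>z. vec_of_pair (prod.swap z)) = lborel"
  "(\<lambda>z. vec_of_pair (prod.swap z)) \<in> borel_measurable borel"
proof -
  show "(\<lambda>z. vec_of_pair (prod.swap z)) \<in> borel_measurable borel" by measurable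
  have "lborel = distr (distr lborel borel prod.swap) borel vec_of_pair"
    by (simp only: distr_lborel_swap distr_vec_of_pair)
  also have "\<dots> = distr lborel borel (vec_of_pair \<circ> prod.swap)"
    by (rule distr_distr) simp_all
  finally show "distr lborel borel (\<lambda>z. vec_of_pair (prod.swap z)) = lborel" by (simp add: comp_def)
qed

text \<open>Membership in \<open>W12\<close> provides some weak derivative, so the choice made by
  \<open>weak_partial\<close> is a genuine one.\<close>

lemma W12_weak_partial:
  assumes "S \<in> W12"
  shows "square_integrable (\<lambda>x. S x $ j)" "has_weak_partial i (\<lambda>x. S x $ j) (weak_partial i (\<lambda>x. S x $ j))"
proof -
  show "square_integrable (\<lambda>x. S x $ j)"
    using assms by (simp add: W12_def)
  have "\<exists>g. has_weak_partial i (\<lambda>x. S x $ j) g"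
    using assms unfolding W12_def by blast
  then show "has_weak_partial i (\<lambda>x. S x $ j) (weak_partial i (\<lambda>x. S x $ j))"
    unfolding weak_partial_def by (rule someI_ex)
qed

lemma ex_borel_version:
  fixes f :: "'a::euclidean_space \<Rightarrow> real"
  assumes "f \<in> borel_measurable lebesgue"
  obtains g where "g \<in> borel_measurable borel" "AE x in lborel. f x = g x"
proof -
  obtain g where "g \<in> borel_measurable lborel" "AE x in lborel. f x = g x"
    using completion_ex_borel_measurable_real[OF assms] by (rule bexE)
  then show ?thesis using that[of g] by simp
qed

text \<open>Collects what the inequality on pairs asks of a single field, to be used for
  \<open>S\<close> and \<open>T\<close> alike. The derivatives recorded are the diagonal ones, of
  which the divergence is the sum.\<close>

definition borel_version :: "(real ^ 2 \<Rightarrow> real ^ 2) \<Rightarrow> (real ^ 2 \<Rightarrow> real) \<Rightarrow> (real ^ 2 \<Rightarrow> real) \<Rightarrow>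
    (real ^ 2 \<Rightarrow> real) \<Rightarrow> (real ^ 2 \<Rightarrow> real) \<Rightarrow> bool" where
  "borel_version S p q u v \<longleftrightarrow>
    p \<in> borel_measurable borel \<and> q \<in> borel_measurable borel \<and> u \<in> borel_measurable borel \<and> v \<in> borel_measurable borel \<and>
    (AE x in lborel. S x $ 1 = p x) \<and> (AE x in lborel. S x $ 2 = q x) \<and> (AE x in lborel. weak_div S x = u x + v x) \<and>
    loc_integrable (\<lambda>z. p (vec_of_pair z)) \<and> loc_integrable (\<lambda>z. q (vec_of_pair z)) \<and>
    loc_integrable (\<lambda>z. u (vec_of_pair z)) \<and> loc_integrable (\<lambda>z. v (vec_of_pair z)) \<and>
    integrable lborel (\<lambda>z. (p (vec_of_pair z))\<^sup>2) \<and> integrable lborel (\<lambda>z. (q (vec_of_pair z))\<^sup>2) \<and>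
    weak_dx (\<lambda>z. p (vec_of_pair z)) (\<lambda>z. u (vec_of_pair z)) \<and>
    weak_dx (\<lambda>z. q (vec_of_pair (prod.swap z))) (\<lambda>z. v (vec_of_pair (prod.swap z)))"

lemma ex_borel_version_W12:
  fixes S :: "real ^ 2 \<Rightarrow> real ^ 2"
  assumes S: "S \<in> W12"
  obtains p q u v where "borel_version S p q u v"
proof -
  let ?U = "weak_partial 1 (\<lambda>x. S x $ 1)" and ?V = "weak_partial 2 (\<lambda>x. S x $ 2)"
  note w = W12_weak_partial(2)[OF S, of 1 1] W12_weak_partial(2)[OF S, of 2 2]
  note sq = W12_weak_partial(1)[OF S]
  have U: "?U \<in> borel_measurable lebesgue" and V: "?V \<in> borel_measurable lebesgue"
    using w by (auto simp: has_weak_partial_def intro: locally_integrable_borel_measurable)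
  obtain u where u: "u \<in> borel_measurable borel" "AE x in lborel. ?U x = u x"
    by (rule ex_borel_version[OF U])
  obtain v where v: "v \<in> borel_measurable borel" "AE x in lborel. ?V x = v x"
    by (rule ex_borel_version[OF V])
  have Sm: "(\<lambda>x. S x $ j) \<in> borel_measurable lebesgue" for j
    using sq[of j] by (simp add: square_integrable_def)
  obtain p where p: "p \<in> borel_measurable borel" "AE x in lborel. S x $ 1 = p x"
    by (rule ex_borel_version[OF Sm])
  obtain q where q: "q \<in> borel_measurable borel" "AE x in lborel. S x $ 2 = q x"
    by (rule ex_borel_version[OF Sm])
  have div: "AE x in lborel. weak_div S x = u x + v x"
    using u(2) v(2) by eventually_elim (simp add: weak_div_def UNIV_2)
  have 12: "(1::2) \<noteq> 2" "(2::2) \<noteq> 1" by auto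
  note x = weak_partial_planar[OF w(1) 12(1) p(1) u(1) p(2) u(2) measurable_vec_of_pair distr_vec_of_pair vec_of_pair_nth]
  have y: "weak_dx (\<lambda>z. q (vec_of_pair (prod.swap z))) (\<lambda>z. v (vec_of_pair (prod.swap z)))"
    "loc_integrable (\<lambda>z. q (vec_of_pair (prod.swap z)))" "loc_integrable (\<lambda>z. v (vec_of_pair (prod.swap z)))"
    by (rule weak_partial_planar[OF w(2) 12(2) q(1) v(1) q(2) v(2) vec_of_pair_swap(2,1)]; simp)+
  have y': "loc_integrable (\<lambda>z. q (vec_of_pair z))" "loc_integrable (\<lambda>z. v (vec_of_pair z))"
    using loc_integrable_swap[OF y(2)] loc_integrable_swap[OF y(3)] by simp_all
  have "borel_version S p q u v"
    unfolding borel_version_def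
    by (intro conjI p(1) q(1) u(1) v(1) p(2) q(2) div x y(1) y'
        square_integrable_vec_of_pair[OF sq p(2,1)] square_integrable_vec_of_pair[OF sq q(2,1)])
  then show ?thesis by (rule that)
qed

text \<open>Extended nonnegative integrals are used because divergences of such fields are known to
  be square integrable only and may have infinite L^1 norm.\<close>

theorem theorem1p6:
  fixes S T :: "real ^ 2 \<Rightarrow> real ^ 2"
  assumes "S \<in> W12" and "T \<in> W12"
    and "AE z in lebesgue. S z $ 1 \<ge> 0"
    and "AE z in lebesgue. T z $ 2 \<ge> 0"
    and "AE z in lebesgue. det2 (S z) (T z) \<ge> 0"
  shows "(\<integral>\<^sup>+ z. ennreal (det2 (S z) (T z)) \<partial>lebesgue)
    \<le> ennreal (1 / 4) * (\<integral>\<^sup>+ z. ennreal \<bar>weak_div S z\<bar> \<partial>lebesgue)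
                       * (\<integral>\<^sup>+ z. ennreal \<bar>weak_div T z\<bar> \<partial>lebesgue)"
proof -
  let ?e = vec_of_pair
  obtain p q u v where pquv: "borel_version S p q u v"
    by (rule ex_borel_version_W12[OF assms(1)])
  obtain r w al be where rwab: "borel_version T r w al be"
    by (rule ex_borel_version_W12[OF assms(2)])
  have S: "p \<in> borel_measurable borel" "q \<in> borel_measurable borel" "u \<in> borel_measurable borel" "v \<in> borel_measurable borel"
    "AE x in lborel. S x $ 1 = p x" "AE x in lborel. S x $ 2 = q x" "AE x in lborel. weak_div S x = u x + v x"
    "loc_integrable (\<lambda>z. p (?e z))" "loc_integrable (\<lambda>z. q (?e z))"
    "loc_integrable (\<lambda>z. u (?e z))" "loc_integrable (\<lambda>z. v (?e z))"
    "integrable lborel (\<lambda>z. (p (?e z))\<^sup>2)" "integrable lborel (\<lambda>z. (q (?e z))\<^sup>2)"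
    "weak_dx (\<lambda>z. p (?e z)) (\<lambda>z. u (?e z))"
    "weak_dx (\<lambda>z. q (?e (prod.swap z))) (\<lambda>z. v (?e (prod.swap z)))"
    using pquv unfolding borel_version_def by blast+
  have T: "r \<in> borel_measurable borel" "w \<in> borel_measurable borel" "al \<in> borel_measurable borel" "be \<in> borel_measurable borel"
    "AE x in lborel. T x $ 1 = r x" "AE x in lborel. T x $ 2 = w x" "AE x in lborel. weak_div T x = al x + be x"
    "loc_integrable (\<lambda>z. r (?e z))" "loc_integrable (\<lambda>z. w (?e z))"
    "loc_integrable (\<lambda>z. al (?e z))" "loc_integrable (\<lambda>z. be (?e z))"
    "integrable lborel (\<lambda>z. (r (?e z))\<^sup>2)" "integrable lborel (\<lambda>z. (w (?e z))\<^sup>2)"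
    "weak_dx (\<lambda>z. r (?e z)) (\<lambda>z. al (?e z))"
    "weak_dx (\<lambda>z. w (?e (prod.swap z))) (\<lambda>z. be (?e (prod.swap z)))"
    using rwab unfolding borel_version_def by blast+
  note [measurable] = S(1-4) T(1-4)
  have det: "AE x in lborel. det2 (S x) (T x) = p x * w x - q x * r x"
    using S(5,6) T(5,6) by eventually_elim (simp add: det2_def)
  have "AE x in lborel. S x $ 1 \<ge> 0" "AE x in lborel. T x $ 2 \<ge> 0" "AE x in lborel. det2 (S x) (T x) \<ge> 0"
    using assms(3-5) by (simp_all add: AE_completion_iff)
  note lb = this
  have "AE x in lborel. 0 \<le> p x"
    using lb(1) S(5) by eventually_elim simp
  note pos1 = AE_vec_of_pair[OF this]
  have "AE x in lborel. 0 \<le> w x"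
    using lb(2) T(6) by eventually_elim simp
  note pos2 = AE_vec_of_pair[OF this]
  have "AE x in lborel. 0 \<le> p x * w x - q x * r x"
    using lb(3) det by eventually_elim simp
  note pos3 = AE_vec_of_pair[OF this]
  have divS: "AE x in lborel. \<bar>weak_div S x\<bar> = \<bar>u x + v x\<bar>"
    using S(7) by eventually_elim simp
  have divT: "AE x in lborel. \<bar>weak_div T x\<bar> = \<bar>al x + be x\<bar>"
    using T(7) by eventually_elim simp
  have "(\<integral>\<^sup>+ x. ennreal (det2 (S x) (T x)) \<partial>lebesgue) = (\<integral>\<^sup>+ z. ennreal (p (?e z) * w (?e z) - q (?e z) * r (?e z)) \<partial>lborel)"
    by (rule nn_integral_vec_of_pair[OF det]) measurable
  also have "\<dots> \<le> ennreal (1 / 4) * (\<integral>\<^sup>+ z. ennreal \<bar>u (?e z) + v (?e z)\<bar> \<partial>lborel) * (\<integral>\<^sup>+ z. ennreal \<bar>al (?e z) + be (?e z)\<bar> \<partial>lborel)"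
    by (rule nn_integral_det_le[OF S(8,9) T(8,9) S(10,11) T(10,11) S(12,13) T(12,13) S(14) T(14) S(15) T(15) pos1 pos2 pos3])
  also have "(\<integral>\<^sup>+ z. ennreal \<bar>u (?e z) + v (?e z)\<bar> \<partial>lborel) = (\<integral>\<^sup>+ x. ennreal \<bar>weak_div S x\<bar> \<partial>lebesgue)"
    by (rule nn_integral_vec_of_pair[OF divS, symmetric]) measurable
  also have "(\<integral>\<^sup>+ z. ennreal \<bar>al (?e z) + be (?e z)\<bar> \<partial>lborel) = (\<integral>\<^sup>+ x. ennreal \<bar>weak_div T x\<bar> \<partial>lebesgue)"
    by (rule nn_integral_vec_of_pair[OF divT, symmetric]) measurable
  finally show ?thesis .
qed

end
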